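(* Let $X$ be the number of bulbs on at the terminal time $n$ in the standard lightbulb process on $n$ bulbs, and let $Z$ be a standard normal random variable. (i) For all even $n \ge 6$, with $$\sigma^2=\frac{n}{4}\left(1-\lambda_{n,2,\mathbf{n}}\right)+\frac{n^2}{4}\lambda_{n,2,\mathbf{n}},$$ we have $$\sup_{z\in\mathbb{R}}\left|P\left(\frac{X-n/2}{\sigma}\le z\right)-P(Z\le z)\right|\le \frac{n}{2\sigma^2}\overline{\Delta}_0+1.64\frac{n}{\sigma^3}+\frac{2}{\sigma},\qquad \overline{\Delta}_0=\frac{1}{2\sqrt{n}}+\frac{1}{2n}+\frac13 e^{-n/2}.$$ (ii) For all odd $n=2m+1\ge 7$, with $$\sigma_V^2=\frac{n}{4}\left(1-\overline{\lambda}_{n,2,\mathbf{n}}\right)+\frac{n^2}{4}\overline{\lambda}_{n,2,\mathbf{n}},$$ we have $$\sup_{z\in\mathbb{R}}\left|P\left(\frac{X-n/2}{\sigma_V}\le z\right)-P(Z\le z)\right|\le \frac{n}{2\sigma_V^2}\overline{\Delta}_1+1.64\frac{n}{\sigma_V^3}+\frac{2}{\sigma_V}\left(1+\frac{1}{\sqrt{2\pi}}\right),\qquad \overline{\Delta}_1=\frac{1}{\sqrt{n}}+\frac{1}{2\sqrt2}e^{-n/4}.$$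
   Context: Lightbulb process: there are $n$ bulbs, all initially off, and $k$ stages with switch pattern $\mathbf{s}=(s_1,\dots,s_k)$, $s_r\in\{0,\dots,n\}$. At stage $r$ a subset of exactly $s_r$ of the $n$ bulbs is chosen uniformly at random, independently of the other stages, and each chosen bulb has its status toggled (off to on or on to off). Formally, switch variables $X_{rj}\in\{0,1\}$ ($r=1,\dots,k$, $j=1,\dots,n$) have $P(X_{rj}=e_{rj}\ \forall r,j)=\prod_{r=1}^k\binom{n}{s_r}^{-1}$ if $\sum_j e_{rj}=s_r$ for all $r$ and $0$ otherwise; $X_j=(\sum_r X_{rj})\bmod 2$ indicates bulb $j$ is on at the end, and $X_{\mathbf{s}}=\sum_j X_j$. The standard lightbulb process is the case $k=n$, $\mathbf{s}=\mathbf{n}=(1,2,\dots,n)$ (on day $r$ exactly $r$ bulbs are toggled), and $X=X_{\mathbf{n}}$. For integers $n,b,s$ define $(n)_t=n(n-1)\cdots(n-t+1)$, $$\lambda_{n,b,s}=\sum_{t=0}^b\binom{b}{t}(-2)^t\frac{(s)_t}{(n)_t},\qquad \lambda_{n,b,\mathbf{s}}=\prod_{r=1}^k\lambda_{n,b,s_r}.$$ For $n=2m+1$ odd, $\overline{\lambda}_{n,b,\mathbf{n}}$ is obtained from $\lambda_{n,b,\mathbf{n}}=\prod_{s=1}^n\lambda_{n,b,s}$ by replacing each of the factors $\lambda_{n,b,m}$ and $\lambda_{n,b,m+1}$ by their average $\frac12(\lambda_{n,b,m}+\lambda_{n,b,m+1})$. *)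

theory Defs
  imports "HOL-Probability.Probability"
begin

text \<open>Lightbulb process with n bulbs (indexed 0..<n) and k stages with switch
pattern s (stage r in 1..k toggles exactly s r bulbs).  An outcome is the
family of chosen subsets S r (r = 1..k); all outcomes are equally likely,
i.e. the subsets are chosen uniformly and independently.\<close>

definition lb_outcomes :: "nat \<Rightarrow> nat \<Rightarrow> (nat \<Rightarrow> nat) \<Rightarrow> (nat \<Rightarrow> nat set) set" where
  "lb_outcomes n k s =
     {S. (\<forall>r\<in>{1..k}. S r \<subseteq> {..<n} \<and> card (S r) = s r) \<and> (\<forall>r. r \<notin> {1..k} \<longrightarrow> S r = {})}"

definition lb_pmf :: "nat \<Rightarrow> nat \<Rightarrow> (nat \<Rightarrow> nat) \<Rightarrow> (nat \<Rightarrow> nat set) pmf" where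
  "lb_pmf n k s = pmf_of_set (lb_outcomes n k s)"

text \<open>Number of bulbs that are on at the end: bulb j is on iff it was toggled an odd number of times.\<close>
definition lb_count :: "nat \<Rightarrow> nat \<Rightarrow> (nat \<Rightarrow> nat set) \<Rightarrow> nat" where
  "lb_count n k S = card {j. j < n \<and> odd (card {r \<in> {1..k}. j \<in> S r})}"

definition std_lb_pmf :: "nat \<Rightarrow> (nat \<Rightarrow> nat set) pmf" where
  "std_lb_pmf n = lb_pmf n n (\<lambda>r. r)"

definition std_lb_X :: "nat \<Rightarrow> (nat \<Rightarrow> nat set) \<Rightarrow> nat" where
  "std_lb_X n = lb_count n n"

definition ffall :: "nat \<Rightarrow> nat \<Rightarrow> real" where
  "ffall x t = (\<Prod>i<t. (real x - real i))"

definition lam :: "nat \<Rightarrow> nat \<Rightarrow> nat \<Rightarrow> real" where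
  "lam n b s = (\<Sum>t=0..b. real (b choose t) * (-2) ^ t * ffall s t / ffall n t)"

definition lam_std :: "nat \<Rightarrow> nat \<Rightarrow> real" where
  "lam_std n b = (\<Prod>s=1..n. lam n b s)"

definition lam_bar_std :: "nat \<Rightarrow> nat \<Rightarrow> real" where
  "lam_bar_std n b =
     (let m = n div 2 in
       (\<Prod>s\<in>{1..n} - {m, m+1}. lam n b s) * ((lam n b m + lam n b (m+1)) / 2) ^ 2)"

definition std_normal_cdf :: "real \<Rightarrow> real" where
  "std_normal_cdf z = measure (density lborel std_normal_density) {..z}"

end

theory Submission
  imports Defs
begin

text \<open>
  The law of the final configuration is the convolution on the hypercube of the uniform laws on the
  \<open>s\<close>-subsets, so its Walsh coefficient at \<open>B\<close> is the product over \<open>s\<close> of \<open>\<lambda> = lam n (card B) s\<close>. By Plancherel each factor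
  satisfies \<open>(n choose card B) \<lambda>\<^sup>2 \<le> 2^n / (n choose s)\<close>, and ten values of \<open>s\<close> near \<open>n/2\<close> already make
  the product negligible unless \<open>B\<close> is empty or full. Hence \<open>X\<close> is, up to \<open>O(1/n)\<close> in total variation, a
  symmetric binomial conditioned on its parity, which by Pascal's rule has the distribution function of
  a binomial with \<open>n - 1\<close> trials at every lattice point of the right parity.

  For the latter, Stein's method needs no smoothing: if the level is a lattice point, the Stein
  solution is smooth between neighbouring lattice points, and the binomial Stein identity is a
  telescoping sum, so the error is that of a trapezoidal rule, at most \<open>8/sqrt n\<close>. Since \<open>\<sigma>\<^sup>2\<close> is
  extremely close to \<open>n/4\<close>, the terms \<open>1.64 n/\<sigma>\<^sup>3 + 2/\<sigma>\<close> alone exceed \<open>16/sqrt n\<close>, which dominates all errors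
  for \<open>n \<ge> 256\<close> and is at least \<open>1\<close> below.
\<close>

section \<open>The standard normal distribution function\<close>

lemma std_normal_cdf_eq_cdf: "std_normal_cdf = cdf std_normal_distribution"
  by (simp add: fun_eq_iff std_normal_cdf_def cdf_def)

lemma std_normal_cdf_bounds: "0 \<le> std_normal_cdf x" "std_normal_cdf x \<le> 1"
proof -
  interpret real_distribution std_normal_distribution by (rule real_dist_normal_dist)
  show "0 \<le> std_normal_cdf x" "std_normal_cdf x \<le> 1"
    by (simp_all add: std_normal_cdf_eq_cdf cdf_nonneg cdf_bounded_prob)
qed

lemma std_normal_cdf_at_top: "(std_normal_cdf \<longlongrightarrow> 1) at_top"
proof -
  interpret real_distribution std_normal_distribution by (rule real_dist_normal_dist)
  show ?thesis by (simp add: std_normal_cdf_eq_cdf cdf_lim_at_top_prob)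
qed

lemma std_normal_cdf_at_bot: "(std_normal_cdf \<longlongrightarrow> 0) at_bot"
proof -
  interpret real_distribution std_normal_distribution by (rule real_dist_normal_dist)
  show ?thesis by (simp add: std_normal_cdf_eq_cdf cdf_lim_at_bot)
qed

lemma std_normal_density_deriv [derivative_intros]:
  assumes "(g has_real_derivative g') (at x within A)"
  shows "((\<lambda>x. std_normal_density (g x)) has_real_derivative - g x * std_normal_density (g x) * g') (at x within A)"
  unfolding normal_density_def by (rule derivative_eq_intros refl assms | simp)+

lemma continuous_on_std_normal_density: "continuous_on A std_normal_density"
  by (auto simp: normal_density_def intro!: continuous_intros)

lemma std_normal_cdf_diff:
  assumes "a \<le> b"
  shows "std_normal_cdf b = std_normal_cdf a + integral {a..b} std_normal_density"
proof -
  interpret real_distribution std_normal_distribution by (rule real_dist_normal_dist)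
  have int: "set_integrable lborel {a..b} std_normal_density"
    by (intro borel_integrable_atLeastAtMost' continuous_on_std_normal_density)
  have "std_normal_cdf b - std_normal_cdf a = measure std_normal_distribution {a<..b}"
    using assms cdf_diff_eq[of a b] by (cases "a = b") (auto simp: std_normal_cdf_eq_cdf)
  also have "\<dots> = measure std_normal_distribution {a..b}"
  proof -
    have "AE x in std_normal_distribution. x \<noteq> a"
      by (subst AE_density) (use AE_lborel_singleton[of a] in auto)
    then have "AE x in std_normal_distribution. (x \<in> {a<..b}) = (x \<in> {a..b})"
      by eventually_elim (use assms in auto)
    then show ?thesis by (intro measure_eq_AE) auto
  qed
  also have "\<dots> = (LINT x|std_normal_distribution. indicator {a..b} x)"
    by simp
  also have "\<dots> = (LINT x:{a..b}|lborel. std_normal_density x)"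
    unfolding set_lebesgue_integral_def
    by (subst integral_density) (auto simp: mult.commute)
  also have "\<dots> = integral {a..b} std_normal_density"
    using set_borel_integral_eq_integral(2)[OF int] by simp
  finally show ?thesis by simp
qed

lemma std_normal_cdf_deriv [derivative_intros]:
  assumes "(g has_real_derivative g') (at x within A)"
  shows "((\<lambda>x. std_normal_cdf (g x)) has_real_derivative std_normal_density (g x) * g') (at x within A)"
proof -
  have *: "(std_normal_cdf has_real_derivative std_normal_density y) (at y)" for y
  proof -
    \<comment> \<open>The base point \<open>y - 1\<close> puts \<open>y\<close> in the interior of
      the interval, where the derivative within the interval is the full derivative.\<close>
    have "((\<lambda>u. integral {y-1..u} std_normal_density) has_real_derivative std_normal_density y) 
            (at y within {y-1..y+1})"
      by (intro integral_has_real_derivative continuous_on_std_normal_density) auto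
    then have "((\<lambda>u. integral {y-1..u} std_normal_density) has_real_derivative std_normal_density y) (at y)"
      by (subst (asm) at_within_interior) (auto simp: interior_atLeastAtMost_real)
    then have "((\<lambda>u. std_normal_cdf (y-1) + integral {y-1..u} std_normal_density) has_real_derivative std_normal_density y) (at y)"
      by (auto intro!: derivative_eq_intros)
    then show ?thesis
    proof (rule has_field_derivative_transform_within_open[where S="{y-1<..}"])
      show "\<And>u. u \<in> {y-1<..} \<Longrightarrow> std_normal_cdf (y-1) + integral {y-1..u} std_normal_density = std_normal_cdf u"
        by (rule std_normal_cdf_diff[symmetric]) auto
    qed auto
  qed
  show ?thesis using DERIV_chain2[OF * assms] .
qed

lemma std_normal_density_le_1: "std_normal_density x \<le> 1"
proof -
  have "1 \<le> sqrt (2 * pi)" using pi_gt3 by simp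
  moreover have "exp (- x\<^sup>2 / 2) \<le> 1" by simp
  ultimately have "exp (- x\<^sup>2 / 2) \<le> sqrt (2 * pi)" by (rule order_trans[rotated])
  then show ?thesis by (simp add: std_normal_density_def divide_le_eq)
qed

lemma std_normal_cdf_mono: "x \<le> y \<Longrightarrow> std_normal_cdf x \<le> std_normal_cdf y"
proof -
  interpret real_distribution std_normal_distribution by (rule real_dist_normal_dist)
  show "x \<le> y \<Longrightarrow> std_normal_cdf x \<le> std_normal_cdf y"
    by (simp add: std_normal_cdf_eq_cdf cdf_nondecreasing)
qed

lemma std_normal_cdf_lipschitz: "\<bar>std_normal_cdf x - std_normal_cdf y\<bar> \<le> \<bar>x - y\<bar>"
proof (induction x y rule: linorder_wlog)
  case (le x y)
  show ?case
  proof (cases "x = y")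
    case False
    then obtain c where "std_normal_cdf y - std_normal_cdf x = (y - x) * std_normal_density c"
      using MVT2[of x y std_normal_cdf std_normal_density] le
        std_normal_cdf_deriv[OF DERIV_ident] by fastforce
    then show ?thesis using le std_normal_density_le_1[of c] std_normal_cdf_mono[of x y]
      by (simp add: abs_if mult_left_le)
  qed simp
qed (simp add: abs_minus_commute)

text \<open>Mean value theorem in the scale: \<Phi>(t z) has t-derivative z \<phi>(t z), and |u|
  \<phi>(u) is at most 1, so the bound is uniform in \<open>z\<close>. It later exchanges \<sigma>
  for sqrt n / 2.\<close>

lemma std_normal_cdf_scale:
  assumes "a > 0"
  shows "\<bar>std_normal_cdf (a * z) - std_normal_cdf z\<bar> \<le> \<bar>a - 1\<bar> * max 1 (1 / a)"
proof -
  have aux: "\<bar>std_normal_cdf (b * z) - std_normal_cdf (c * z)\<bar> \<le> (c - b) / b" if "0 < b" "b \<le> c" for b c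
  proof (cases "b = c")
    case False
    then have "\<exists>t>b. t < c \<and> std_normal_cdf (c * z) - std_normal_cdf (b * z) = (c - b) * (std_normal_density (t * z) * z)"
      using that by (intro MVT2) (auto intro!: derivative_eq_intros)
    then obtain t where t: "b < t"
      "std_normal_cdf (c * z) - std_normal_cdf (b * z) = (c - b) * (std_normal_density (t * z) * z)"
      by blast
    have "\<bar>t * z\<bar> * exp (- (t*z)\<^sup>2 / 2) \<le> 1"
    proof -
      have "(\<bar>t*z\<bar> - 1)\<^sup>2 \<ge> 0" by simp
      then have "\<bar>t * z\<bar> \<le> 1 + (t*z)\<^sup>2/2" by (simp add: power2_diff)
      also have "\<dots> \<le> exp ((t*z)\<^sup>2/2)" by (rule exp_ge_add_one_self)
      finally show ?thesis by (simp add: exp_minus field_simps)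
    qed
    moreover have "1 \<le> sqrt (2 * pi)" using pi_gt3 by simp
    ultimately have "\<bar>t * z\<bar> * std_normal_density (t * z) \<le> 1"
      using order_trans[of "\<bar>t * z\<bar> * exp (- (t*z)\<^sup>2 / 2)" 1 "sqrt (2 * pi)"]
      by (simp add: std_normal_density_def divide_le_eq)
    then have "t * (std_normal_density (t * z) * \<bar>z\<bar>) \<le> 1" using t that by (simp add: abs_mult mult_ac)
    then have "std_normal_density (t * z) * \<bar>z\<bar> \<le> 1 / t" using t that by (simp add: field_simps)
    also have "\<dots> \<le> 1 / b" using t that by (simp add: field_simps)
    finally have "(c - b) * (std_normal_density (t * z) * \<bar>z\<bar>) \<le> (c - b) * (1 / b)"
      using that by (intro mult_left_mono) auto
    moreover have "\<bar>std_normal_cdf (b * z) - std_normal_cdf (c * z)\<bar> = (c - b) * (std_normal_density (t * z) * \<bar>z\<bar>)"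
      using t(2) that by (subst abs_minus_commute) (simp add: abs_mult)
    ultimately show ?thesis by simp
  qed (use that in auto)
  show ?thesis
  proof (cases "a \<le> 1")
    case True
    have "\<bar>std_normal_cdf (a * z) - std_normal_cdf z\<bar> \<le> \<bar>a - 1\<bar> * (1 / a)"
      using aux[of a 1] assms True by simp
    also have "\<dots> \<le> \<bar>a - 1\<bar> * max 1 (1 / a)" by (intro mult_left_mono) auto
    finally show ?thesis .
  next
    case False
    have "\<bar>std_normal_cdf (a * z) - std_normal_cdf z\<bar> \<le> \<bar>a - 1\<bar> * 1"
      using aux[of 1 a] False by (simp add: abs_minus_commute)
    also have "\<dots> \<le> \<bar>a - 1\<bar> * max 1 (1 / a)" by (intro mult_left_mono) auto
    finally show ?thesis .
  qed
qed

section \<open>Symmetry and tail bounds of the normal distribution\<close>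

text \<open>As the density is even, \<Phi>(y) + \<Phi>(-y) has derivative zero; it tends to 1 at
  infinity.\<close>

lemma std_normal_cdf_minus: "std_normal_cdf (- x) = 1 - std_normal_cdf x"
proof -
  define S where "S = (\<lambda>x. std_normal_cdf x + std_normal_cdf (- x))"
  have "(S has_real_derivative 0) (at y)" for y
    unfolding S_def by (auto intro!: derivative_eq_intros simp: std_normal_density_def)
  then have const: "S x = S y" for y using DERIV_isconst_all[of S] by blast
  have "filterlim (uminus :: real \<Rightarrow> real) at_bot at_top" by (rule filterlim_uminus_at_bot_at_top)
  then have "((\<lambda>y. std_normal_cdf (- y)) \<longlongrightarrow> 0) at_top"
    by (rule filterlim_compose[OF std_normal_cdf_at_bot])
  then have "(S \<longlongrightarrow> 1 + 0) at_top"
    unfolding S_def by (intro tendsto_add std_normal_cdf_at_top)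
  moreover have "(S \<longlongrightarrow> S x) at_top"
    by (intro tendsto_eventually always_eventually allI const[symmetric])
  ultimately have "S x = 1 + 0" by (rule tendsto_unique[OF trivial_limit_at_top_linorder, rotated])
  then show ?thesis by (simp add: S_def)
qed

text \<open>The map y -> x \<Phi>(y) + \<phi>(y) has derivative (x - y) \<phi>(y), hence decreases
  for y \<ge> x; its value at \<open>x\<close> is compared with its limit at infinity.\<close>

lemma mills_ratio:
  assumes "x > 0"
  shows "x * (1 - std_normal_cdf x) \<le> std_normal_density x"
proof -
  have "x * std_normal_cdf y \<le> x * std_normal_cdf x + std_normal_density x" if "x \<le> y" for y
  proof -
    have "x * std_normal_cdf y + std_normal_density y \<le> x * std_normal_cdf x + std_normal_density x"
      using that
    proof (rule DERIV_nonpos_imp_nonincreasing)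
      fix t assume "x \<le> t" "t \<le> y"
      then have "(x - t) * std_normal_density t \<le> 0" by (intro mult_nonpos_nonneg) auto
      then show "\<exists>d. ((\<lambda>t. x * std_normal_cdf t + std_normal_density t) has_real_derivative d) (at t) \<and> d \<le> 0"
        by (intro exI[of _ "(x - t) * std_normal_density t"] conjI)
           (auto intro!: derivative_eq_intros simp: algebra_simps)
    qed
    then show ?thesis using normal_density_nonneg[of 0 1 y] by linarith
  qed
  then have "\<forall>\<^sub>F y in at_top. x * std_normal_cdf y \<le> x * std_normal_cdf x + std_normal_density x"
    by (auto intro: eventually_at_top_linorderI)
  moreover have "((\<lambda>y. x * std_normal_cdf y) \<longlongrightarrow> x * 1) at_top"
    by (intro tendsto_intros std_normal_cdf_at_top)
  ultimately have "x * 1 \<le> x * std_normal_cdf x + std_normal_density x"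
    by (intro tendsto_upperbound[where F=at_top]) auto
  then show ?thesis by (simp add: algebra_simps)
qed

text \<open>The Mills bound suffices for x > 1. For x \<le> 1 the right side is already at least 1:
  the constant 5 is the product of the bounds 20/7 for sqrt (2 pi) and 7/4 for exp (x^2 /
  2).\<close>

lemma mills_ratio_bounded:
  assumes "x \<ge> 0"
  shows "1 - std_normal_cdf x \<le> 5 * std_normal_density x"
proof (cases "x \<le> 1")
  case True
  have "exp (x\<^sup>2 / 2) \<le> exp (1/2 :: real)" using True assms by (simp add: power_le_one)
  also have "exp (1/2 :: real) \<le> 1 + 1/2 + (1/2)\<^sup>2" by (rule exp_bound) auto
  finally have e: "exp (x\<^sup>2 / 2) \<le> 7/4" by (simp add: power2_eq_square)
  have p: "sqrt (2 * pi) \<le> 20/7" using pi_less_4 by (intro real_le_lsqrt) (auto simp: power2_eq_square)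
  have "sqrt (2 * pi) * exp (x\<^sup>2 / 2) \<le> 20/7 * (7/4)" using e p by (intro mult_mono) auto
  then have "1 \<le> 5 * std_normal_density x"
    by (simp add: std_normal_density_def exp_minus field_simps)
  then show ?thesis using std_normal_cdf_bounds[of x] by linarith
next
  case False
  then have "1 * (1 - std_normal_cdf x) \<le> x * (1 - std_normal_cdf x)"
    by (intro mult_right_mono) (auto simp: std_normal_cdf_bounds)
  then show ?thesis using mills_ratio[of x] False normal_density_nonneg[of 0 1 x] by (simp del: normal_density_nonneg)
qed

section \<open>Stein's method for the symmetric binomial distribution\<close>

text \<open>The bounded solution f of f'(x) - x f(x) = 1{x \<le> z} - \<Phi>(z); it has a kink at
  \<open>z\<close>.\<close>

definition stein_sol :: "real \<Rightarrow> real \<Rightarrow> real" where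
  "stein_sol z x =
     (if x \<le> z then std_normal_cdf x * (1 - std_normal_cdf z)
      else std_normal_cdf z * (1 - std_normal_cdf x)) / std_normal_density x"

lemma stein_sol_nonneg: "0 \<le> stein_sol z x"
  by (simp add: stein_sol_def std_normal_cdf_bounds)

text \<open>Each numerator is a product of two probabilities; by monotonicity it is at most the
  smaller of \<Phi>(x) and 1 - \<Phi>(x). This makes the Mills bounds apply uniformly in
  \<open>z\<close>.\<close>

lemma stein_sol_le_tail:
  "stein_sol z x \<le> (1 - std_normal_cdf \<bar>x\<bar>) / std_normal_density x"
proof -
  have "std_normal_cdf x * (1 - std_normal_cdf z) \<le> 1 - std_normal_cdf \<bar>x\<bar>" if "x \<le> z"
  proof (cases "x \<ge> 0")
    case True
    have "std_normal_cdf x * (1 - std_normal_cdf z) \<le> 1 * (1 - std_normal_cdf x)"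
      using std_normal_cdf_mono[OF that] by (intro mult_mono) (auto simp: std_normal_cdf_bounds)
    then show ?thesis using True by simp
  next
    case False
    have "std_normal_cdf x * (1 - std_normal_cdf z) \<le> std_normal_cdf x * 1"
      by (intro mult_mono) (auto simp: std_normal_cdf_bounds)
    then show ?thesis using False by (simp add: std_normal_cdf_minus)
  qed
  moreover have "std_normal_cdf z * (1 - std_normal_cdf x) \<le> 1 - std_normal_cdf \<bar>x\<bar>" if "z \<le> x"
  proof (cases "x \<ge> 0")
    case True
    have "std_normal_cdf z * (1 - std_normal_cdf x) \<le> 1 * (1 - std_normal_cdf x)"
      by (intro mult_mono) (auto simp: std_normal_cdf_bounds)
    then show ?thesis using True by simp
  next
    case False
    have "std_normal_cdf z * (1 - std_normal_cdf x) \<le> std_normal_cdf x * 1"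
      using std_normal_cdf_mono[OF that] by (intro mult_mono) (auto simp: std_normal_cdf_bounds)
    then show ?thesis using False by (simp add: std_normal_cdf_minus)
  qed
  ultimately show ?thesis
    by (auto simp: stein_sol_def intro!: divide_right_mono)
qed

lemma std_normal_density_abs: "std_normal_density \<bar>x\<bar> = std_normal_density x"
  by (simp add: std_normal_density_def)

lemma stein_sol_le: "stein_sol z x \<le> 5"
proof -
  have "0 < std_normal_density x" by (rule normal_density_pos) simp
  then have "(1 - std_normal_cdf \<bar>x\<bar>) / std_normal_density x \<le> 5"
    using mills_ratio_bounded[of "\<bar>x\<bar>"] by (simp add: std_normal_density_abs field_simps)
  then show ?thesis using stein_sol_le_tail[of z x] by linarith
qed

lemma abs_mult_stein_sol_le: "\<bar>x * stein_sol z x\<bar> \<le> 1"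
proof (cases "x = 0")
  case False
  have pos: "0 < std_normal_density x" by (rule normal_density_pos) simp
  have "\<bar>x\<bar> * stein_sol z x \<le> \<bar>x\<bar> * ((1 - std_normal_cdf \<bar>x\<bar>) / std_normal_density x)"
    by (intro mult_left_mono stein_sol_le_tail) auto
  also have "\<dots> \<le> 1"
    using mills_ratio[of "\<bar>x\<bar>"] False pos by (simp add: std_normal_density_abs field_simps)
  finally show ?thesis by (simp add: abs_mult stein_sol_nonneg)
qed simp

lemma stein_sol_left_deriv:
  "((\<lambda>x. std_normal_cdf x * c / std_normal_density x) has_real_derivative
     (x * (std_normal_cdf x * c / std_normal_density x) + c)) (at x)"
proof -
  have "std_normal_density x \<noteq> 0" using normal_density_pos[of 1 0 x] by simp
  then show ?thesis
    by (auto intro!: derivative_eq_intros simp: field_simps)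
qed

lemma stein_sol_right_deriv:
  "((\<lambda>x. c * (1 - std_normal_cdf x) / std_normal_density x) has_real_derivative
     (x * (c * (1 - std_normal_cdf x) / std_normal_density x) - c)) (at x)"
proof -
  have "std_normal_density x \<noteq> 0" using normal_density_pos[of 1 0 x] by simp
  then show ?thesis
    by (auto intro!: derivative_eq_intros simp: field_simps)
qed

section \<open>Trapezoidal error between neighbouring lattice points\<close>

text \<open>With g(x) = x f(x), the difference quotient equals g(t) + c at an intermediate t.
  Replacing g(t) by the mean of g(a) and g(b) costs (b - a) / 2 times a Lipschitz constant of
  g.\<close>

lemma stein_ode_trapezoid:
  fixes f :: "real \<Rightarrow> real"
  assumes "a < b"
    and deriv: "\<And>x. a \<le> x \<Longrightarrow> x \<le> b \<Longrightarrow> (f has_real_derivative x * f x + c) (at x)"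
    and f: "\<And>x. a \<le> x \<Longrightarrow> x \<le> b \<Longrightarrow> \<bar>f x\<bar> \<le> 5 \<and> \<bar>x * f x\<bar> \<le> 1"
    and c: "\<bar>c\<bar> \<le> 1"
  shows "\<bar>(f b - f a) / (b - a) - (a * f a + b * f b) / 2 - c\<bar> \<le> (b - a) / 2 * (6 + a\<^sup>2 + b\<^sup>2)"
proof -
  define g where "g = (\<lambda>x. x * f x)"
  \<comment> \<open>The product rule, with f' eliminated by the differential equation.\<close>
  define g' where "g' = (\<lambda>x. f x + x * (x * f x + c))"
  \<comment> \<open>The 6 is 5 from |f| plus 1 from 2 |x| \<le> 1 + x^2; the rest bounds x^2 on the
    interval whatever the signs of \<open>a\<close> and \<open>b\<close>.\<close>
  define L where "L = 6 + a\<^sup>2 + b\<^sup>2"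
  have dg: "(g has_real_derivative g' x) (at x)" if "a \<le> x" "x \<le> b" for x
    unfolding g_def g'_def by (auto intro!: derivative_eq_intros deriv that)
  have L: "\<bar>g' x\<bar> \<le> L" if "a \<le> x" "x \<le> b" for x
  proof -
    have "(\<bar>x\<bar> - 1)\<^sup>2 \<ge> 0" by simp
    then have "2 * \<bar>x\<bar> \<le> 1 + x\<^sup>2" by (simp add: power2_diff)
    also have "x\<^sup>2 \<le> a\<^sup>2 + b\<^sup>2"
    proof (cases "x \<ge> 0")
      case True
      then have "x\<^sup>2 \<le> b\<^sup>2" using that by (intro power_mono) auto
      then show ?thesis by (simp add: add_increasing)
    next
      case False
      then have "(-x)\<^sup>2 \<le> (-a)\<^sup>2" using that by (intro power_mono) auto
      then show ?thesis by (simp add: add_increasing2)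
    qed
    finally have x: "\<bar>x\<bar> * 2 \<le> 1 + a\<^sup>2 + b\<^sup>2" by simp
    have "\<bar>x * (x * f x + c)\<bar> \<le> \<bar>x\<bar> * 2"
      unfolding abs_mult using f[OF that] c by (intro mult_left_mono) auto
    then show ?thesis using x f[OF that] unfolding g'_def L_def by linarith
  qed
  have lip: "\<bar>g y - g x\<bar> \<le> L * (y - x)" if "a \<le> x" "x \<le> y" "y \<le> b" for x y
  proof (cases "x = y")
    case False
    then have "\<exists>t>x. t < y \<and> g y - g x = (y - x) * g' t"
      using that by (intro MVT2 dg) auto
    then obtain t where "x < t" "t < y" "g y - g x = (y - x) * g' t" by blast
    then show ?thesis using L[of t] that by (simp add: abs_mult mult.commute mult_left_mono)
  qed simp
  have avg: "\<bar>u - (v + w) / 2\<bar> \<le> (p + q) / 2" if "\<bar>u - v\<bar> \<le> p" "\<bar>w - u\<bar> \<le> q" for u v w p q :: real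
    using that by (simp add: abs_le_iff field_simps)
  have "\<exists>t>a. t < b \<and> f b - f a = (b - a) * (t * f t + c)"
    using assms by (intro MVT2 deriv) auto
  then obtain t where t: "a < t" "t < b" "f b - f a = (b - a) * (t * f t + c)" by blast
  then have "(f b - f a) / (b - a) = g t + c" using \<open>a < b\<close> by (simp add: g_def)
  moreover have "\<bar>g t - (g a + g b) / 2\<bar> \<le> (L * (t - a) + L * (b - t)) / 2"
    by (rule avg) (use t in \<open>auto intro!: lip\<close>)
  moreover have "(L * (t - a) + L * (b - t)) / 2 = (b - a) / 2 * L" by (simp add: field_simps)
  ultimately show ?thesis by (simp add: g_def L_def)
qed

text \<open>As \<open>z\<close> is not strictly between \<open>a\<close> and \<open>b\<close>, a
  single branch of the solution governs the whole interval.\<close>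

lemma stein_sol_trapezoid:
  fixes a b z :: real
  assumes "a < b" "b \<le> z \<or> z \<le> a"
  shows "\<bar>(stein_sol z b - stein_sol z a) / (b - a)
           - (a * stein_sol z a + b * stein_sol z b) / 2
           - ((if b \<le> z then 1 else 0) - std_normal_cdf z)\<bar> \<le> (b - a) / 2 * (6 + a\<^sup>2 + b\<^sup>2)"
proof (cases "b \<le> z")
  case True
  \<comment> \<open>The branch formula is differentiable on the whole line, so a two-sided
    derivative exists even at b = z, the kink of \<open>stein_sol\<close>.\<close>
  define f where "f = (\<lambda>x. std_normal_cdf x * (1 - std_normal_cdf z) / std_normal_density x)"
  have f: "stein_sol z x = f x" if "x \<le> z" for x
    using that by (simp add: stein_sol_def f_def)
  have "\<bar>(f b - f a) / (b - a) - (a * f a + b * f b) / 2 - (1 - std_normal_cdf z)\<bar>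
         \<le> (b - a) / 2 * (6 + a\<^sup>2 + b\<^sup>2)"
  proof (rule stein_ode_trapezoid[OF \<open>a < b\<close>])
    fix x assume "a \<le> x" "x \<le> b"
    then have "f x = stein_sol z x" using f True by simp
    then show "\<bar>f x\<bar> \<le> 5 \<and> \<bar>x * f x\<bar> \<le> 1"
      using stein_sol_nonneg[of z x] stein_sol_le[of z x] abs_mult_stein_sol_le[of x z] by simp
    show "(f has_real_derivative x * f x + (1 - std_normal_cdf z)) (at x)"
      unfolding f_def by (rule stein_sol_left_deriv)
  qed (use std_normal_cdf_bounds[of z] in auto)
  then show ?thesis using True assms by (simp add: f)
next
  case False
  then have za: "z \<le> a" using assms by simp
  define f where "f = (\<lambda>x. std_normal_cdf z * (1 - std_normal_cdf x) / std_normal_density x)"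
  have f: "stein_sol z x = f x" if "z \<le> x" for x
    using that by (auto simp: stein_sol_def f_def)
  have "\<bar>(f b - f a) / (b - a) - (a * f a + b * f b) / 2 - (- std_normal_cdf z)\<bar>
         \<le> (b - a) / 2 * (6 + a\<^sup>2 + b\<^sup>2)"
  proof (rule stein_ode_trapezoid[OF \<open>a < b\<close>])
    fix x assume "a \<le> x" "x \<le> b"
    then have "f x = stein_sol z x" using f za by simp
    then show "\<bar>f x\<bar> \<le> 5 \<and> \<bar>x * f x\<bar> \<le> 1"
      using stein_sol_nonneg[of z x] stein_sol_le[of z x] abs_mult_stein_sol_le[of x z] by simp
    show "(f has_real_derivative x * f x + - std_normal_cdf z) (at x)"
      unfolding f_def using stein_sol_right_deriv[of "std_normal_cdf z" x] by simp
  qed (use std_normal_cdf_bounds[of z] in auto)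
  then show ?thesis using False za assms by (simp add: f)
qed

section \<open>Discrete Stein identity and the binomial distribution function\<close>

text \<open>Let W be the sum of n fair signs divided by sqrt n, and k the number of plus signs among
  n - 1 of them. Then W is \<open>x k\<close> or \<open>x (Suc k)\<close> with equal chance, and the
  identity says that E[W F(W)] is the mean difference quotient of F.\<close>

lemma binomial_stein_identity:
  fixes F :: "nat \<Rightarrow> real" and n :: nat
  assumes "n > 0"
  defines "x \<equiv> (\<lambda>k. (2 * real k - real n) / sqrt n)"
  shows "(\<Sum>k<n. real ((n - 1) choose k) *
           ((F (Suc k) - F k) / (x (Suc k) - x k) - (x k * F k + x (Suc k) * F (Suc k)) / 2)) = 0"
proof -
  \<comment> \<open>The telescoping potential: it vanishes at k = 0 through the factor k and at k =
    n through the binomial coefficient.\<close>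
  define u where "u = (\<lambda>k. real k * real ((n - 1) choose k) * F k / sqrt n)"
  have s: "sqrt n * sqrt n = n" "sqrt n > 0" using assms by auto
  have "real ((n - 1) choose k) *
           ((F (Suc k) - F k) / (x (Suc k) - x k) - (x k * F k + x (Suc k) * F (Suc k)) / 2)
         = u (Suc k) - u k" if "k < n" for k
  proof -
    have "x (Suc k) - x k = 2 / sqrt n" by (simp add: x_def diff_divide_distrib[symmetric])
    then have "(F (Suc k) - F k) / (x (Suc k) - x k) = (F (Suc k) - F k) * (sqrt n * sqrt n) / (2 * sqrt n)"
      using s(2) by (simp del: real_sqrt_mult_self)
    then have 1: "(F (Suc k) - F k) / (x (Suc k) - x k) = (F (Suc k) - F k) * n / (2 * sqrt n)"
      by (simp only: s(1))
    have "Suc k * ((n - 1) choose Suc k) = (n - 1 - k) * ((n - 1) choose k)"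
      using binomial_absorption[of k "n - 1"] binomial_absorb_comp[of "n - 1" k] by simp
    then have "real (Suc k * ((n - 1) choose Suc k)) = real ((n - 1 - k) * ((n - 1) choose k))" by simp
    then have 2: "real (Suc k) * real ((n - 1) choose Suc k) = (real n - 1 - real k) * real ((n - 1) choose k)"
      using of_nat_diff[of k "n - 1", where 'a = real] that unfolding of_nat_mult by simp
    have 3: "(F (Suc k) - F k) / (x (Suc k) - x k) - (x k * F k + x (Suc k) * F (Suc k)) / 2
       = ((real n - 1 - real k) * F (Suc k) - real k * F k) / sqrt n"
    proof -
      have "(B - A) * n / (2 * r) - ((2 * real k - n) / r * A + (2 * real (Suc k) - n) / r * B) / 2
            = ((real n - 1 - real k) * B - real k * A) / r" if "r > 0" for A B r :: real
        using that by (simp add: field_simps)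
      then show ?thesis unfolding 1 unfolding x_def using s(2) by blast
    qed
    show ?thesis
      unfolding u_def 2 3 by (simp add: algebra_simps diff_divide_distrib add_divide_distrib)
  qed
  then have "(\<Sum>k<n. real ((n - 1) choose k) *
           ((F (Suc k) - F k) / (x (Suc k) - x k) - (x k * F k + x (Suc k) * F (Suc k)) / 2))
         = (\<Sum>k<n. u (Suc k) - u k)" by simp
  also have "\<dots> = u n - u 0" by (rule sum_lessThan_telescope)
  also have "\<dots> = 0" using assms by (simp add: u_def)
  finally show ?thesis .
qed

text \<open>For the Stein solution at level \<open>x m\<close> the identity makes the weighted sum
  of \<open>T f k\<close> vanish, so the error is a weighted sum of trapezoidal errors. The level
  \<open>x m\<close> is the continuity-corrected one for n - 1 trials and the event k < m. The
  constant is 8 = 6 + 2, with 2 from the second moments.\<close>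

proposition binomial_cdf_normal_approx:
  fixes n m :: nat
  assumes "n > 0"
  shows "\<bar>(\<Sum>k<m. real ((n - 1) choose k)) / 2 ^ (n - 1) - std_normal_cdf ((2 * real m - real n) / sqrt n)\<bar>
           \<le> 8 / sqrt n"
proof -
  define x where "x = (\<lambda>k. (2 * real k - real n) / sqrt n)"
  define C where "C = (\<lambda>k. real ((n - 1) choose k))"
  define z where "z = x m"
  define c where "c = (\<lambda>k. (if k < m then 1 else 0) - std_normal_cdf z)"
  define f where "f = (\<lambda>k. stein_sol z (x k))"
  define T where "T = (\<lambda>F k. (F (Suc k) - F k) / (x (Suc k) - x k) - (x k * F k + x (Suc k) * F (Suc k)) / 2)"
  have T0: "(\<Sum>k<n. C k * T F k) = 0" for F
    using binomial_stein_identity[OF assms, of F] by (simp add: C_def T_def x_def)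
  have dx: "x (Suc k) - x k = 2 / sqrt n" for k by (simp add: x_def diff_divide_distrib[symmetric])
  have lt: "x j < x k \<longleftrightarrow> j < k" and le: "x j \<le> x k \<longleftrightarrow> j \<le> k" for j k
    using assms by (auto simp: x_def divide_less_cancel divide_le_cancel)
  have C1: "(\<Sum>k<n. C k) = 2 ^ (n - 1)"
  proof -
    have "{..<n} = {..n - 1}" using assms by auto
    then have "(\<Sum>k<n. C k) = real (\<Sum>k\<le>n - 1. (n - 1) choose k)" by (simp add: C_def)
    then show ?thesis by (simp only: choose_row_sum of_nat_power of_nat_numeral)
  qed
  have step: "\<bar>T f k - c k\<bar> \<le> (6 + (x k)\<^sup>2 + (x (Suc k))\<^sup>2) / sqrt n" for k
  proof -
    have if_eq: "(if x (Suc k) \<le> z then 1 else 0) = (if k < m then 1 else (0::real))"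
      by (simp add: z_def le Suc_le_eq)
    have "\<bar>T f k - c k\<bar> \<le> (x (Suc k) - x k) / 2 * (6 + (x k)\<^sup>2 + (x (Suc k))\<^sup>2)"
      using stein_sol_trapezoid[of "x k" "x (Suc k)" z]
      unfolding T_def f_def c_def if_eq by (simp only: z_def lt le) linarith
    then show ?thesis by (simp add: dx)
  qed
  \<comment> \<open>The identity with F = x, whose difference quotient is 1, evaluates the second
    moments exactly.\<close>
  have sq: "(\<Sum>k<n. C k * ((x k)\<^sup>2 + (x (Suc k))\<^sup>2)) = 2 * 2 ^ (n - 1)"
  proof -
    have "(\<Sum>k<n. C k * ((x k)\<^sup>2 + (x (Suc k))\<^sup>2)) = (\<Sum>k<n. 2 * C k - 2 * (C k * T x k))"
    proof (intro sum.cong refl)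
      fix k
      have "x (Suc k) - x k \<noteq> 0" using assms by (simp add: dx)
      then have T: "T x k = 1 - ((x k)\<^sup>2 + (x (Suc k))\<^sup>2) / 2" by (simp add: T_def power2_eq_square)
      show "C k * ((x k)\<^sup>2 + (x (Suc k))\<^sup>2) = 2 * C k - 2 * (C k * T x k)"
        unfolding T by (simp add: field_simps)
    qed
    also have "\<dots> = 2 * (\<Sum>k<n. C k) - 2 * (\<Sum>k<n. C k * T x k)"
      by (simp add: sum_subtractf sum_distrib_left)
    finally show ?thesis by (simp add: T0 C1)
  qed
  have cdf: "(\<Sum>k<n. C k * c k) = (\<Sum>k<m. C k) - 2 ^ (n - 1) * std_normal_cdf z"
  proof -
    have "(\<Sum>k<n. C k * c k) = (\<Sum>k<n. if k < m then C k else 0) - (\<Sum>k<n. C k) * std_normal_cdf z"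
      unfolding c_def sum_distrib_right sum_subtractf[symmetric] by (intro sum.cong) (auto simp: algebra_simps)
    \<comment> \<open>Here \<open>m\<close> may exceed \<open>n\<close>; the surplus terms have zero
      binomial coefficient.\<close>
    also have "(\<Sum>k<n. if k < m then C k else 0) = (\<Sum>k<m. C k)"
      unfolding sum.inter_filter[symmetric, OF finite_lessThan]
      by (rule sum.mono_neutral_left) (use assms in \<open>auto simp: C_def\<close>)
    finally show ?thesis by (simp add: C1)
  qed
  have "\<bar>\<Sum>k<n. C k * c k\<bar> = \<bar>\<Sum>k<n. C k * (T f k - c k)\<bar>"
    using T0[of f] by (simp add: right_diff_distrib sum_subtractf)
  also have "\<dots> \<le> (\<Sum>k<n. \<bar>C k * (T f k - c k)\<bar>)" by (rule sum_abs)
  also have "\<dots> \<le> (\<Sum>k<n. C k * ((6 + (x k)\<^sup>2 + (x (Suc k))\<^sup>2) / sqrt n))"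
    unfolding abs_mult using step by (intro sum_mono mult_mono) (auto simp: C_def)
  also have "\<dots> = (6 * (\<Sum>k<n. C k) + (\<Sum>k<n. C k * ((x k)\<^sup>2 + (x (Suc k))\<^sup>2))) / sqrt n"
    unfolding sum_distrib_left sum.distrib[symmetric] sum_divide_distrib
    by (intro sum.cong) (simp_all add: algebra_simps)
  also have "\<dots> = 2 ^ (n - 1) * (8 / sqrt n)" by (simp add: C1 sq)
  finally have "\<bar>(\<Sum>k<m. C k) - 2 ^ (n - 1) * std_normal_cdf z\<bar> \<le> 2 ^ (n - 1) * (8 / sqrt n)"
    unfolding cdf .
  moreover have "(\<Sum>k<m. C k) - 2 ^ (n - 1) * std_normal_cdf z
                 = 2 ^ (n - 1) * ((\<Sum>k<m. C k) / 2 ^ (n - 1) - std_normal_cdf z)"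
    by (simp add: field_simps)
  ultimately have "2 ^ (n - 1) * \<bar>(\<Sum>k<m. C k) / 2 ^ (n - 1) - std_normal_cdf z\<bar> \<le> 2 ^ (n - 1) * (8 / sqrt n)"
    by (simp add: abs_mult)
  then show ?thesis unfolding C_def z_def x_def by (subst (asm) mult_le_cancel_left_pos) auto
qed

section \<open>Walsh coefficients of the lightbulb process\<close>

text \<open>The character with index \<open>B\<close> of the group of sets under symmetric
  difference, evaluated at \<open>S\<close>.\<close>

definition walsh :: "nat set \<Rightarrow> nat set \<Rightarrow> real" where
  "walsh B S = (-1) ^ card (B \<inter> S)"

lemma walsh_eq_prod:
  assumes "finite B"
  shows "walsh B S = (\<Prod>j\<in>B. if j \<in> S then -1 else 1)"
  using assms by (simp add: walsh_def prod.If_cases Int_def)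

lemma abs_walsh [simp]: "\<bar>walsh B S\<bar> = 1"
  by (simp add: walsh_def power_abs)

lemma walsh_empty [simp]: "walsh {} S = 1" "walsh S {} = 1"
  by (simp_all add: walsh_def)

lemma walsh_compl:
  assumes "finite V" "B \<subseteq> V" "S \<subseteq> V"
  shows "walsh (V - B) S = (-1) ^ card S * walsh B S"
proof -
  have "finite S" using assms finite_subset by blast
  have "card S = card (B \<inter> S) + card ((V - B) \<inter> S)"
    using assms \<open>finite S\<close> by (subst card_Un_disjoint[symmetric]) (auto intro!: arg_cong[of _ _ card])
  then show ?thesis by (simp add: walsh_def power_add)
qed

text \<open>The sum over \<open>B\<close> is the expansion of the product of all
  \<open>e j + 1\<close>; an element of exactly one of \<open>S\<close>, \<open>S'\<close> makes its
  factor zero.\<close>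

lemma walsh_orthogonal:
  assumes "finite V" "S \<subseteq> V" "S' \<subseteq> V"
  shows "(\<Sum>B\<in>Pow V. walsh B S * walsh B S') = (if S = S' then 2 ^ card V else 0)"
proof -
  define e where "e = (\<lambda>j. (if j \<in> S then -1 else 1) * (if j \<in> S' then -1 else (1::real)))"
  have "(\<Sum>B\<in>Pow V. walsh B S * walsh B S') = (\<Sum>B\<in>Pow V. (\<Prod>j\<in>B. e j) * (\<Prod>j\<in>V - B. 1))"
    using assms by (intro sum.cong) (auto simp: walsh_eq_prod e_def prod.distrib finite_subset)
  also have "\<dots> = (\<Prod>j\<in>V. e j + 1)" using assms by (simp add: prod_add)
  also have "\<dots> = (if S = S' then 2 ^ card V else 0)"
  proof (cases "S = S'")
    case True
    then have "(\<Prod>j\<in>V. e j + 1) = (\<Prod>j\<in>V. 2)" by (intro prod.cong) (auto simp: e_def)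
    then show ?thesis using True by simp
  next
    case False
    then obtain j where "j \<in> V" "j \<in> S \<longleftrightarrow> j \<notin> S'" using assms by auto
    then have "\<exists>j\<in>V. e j + 1 = 0" by (auto simp: e_def)
    then show ?thesis using False assms by (auto intro: prod_zero)
  qed
  finally show ?thesis .
qed

section \<open>Walsh coefficients of the uniform law on sets of fixed size\<close>

definition ksets :: "nat \<Rightarrow> nat \<Rightarrow> nat set set" where
  "ksets n s = {S. S \<subseteq> {..<n} \<and> card S = s}"

lemma finite_ksets [simp]: "finite (ksets n s)"
  by (rule finite_subset[of _ "Pow {..<n}"]) (auto simp: ksets_def)

lemma card_ksets [simp]: "card (ksets n s) = n choose s"
  using n_subsets[of "{..<n}" s] by (simp add: ksets_def)

lemma ksets_nonempty: "s \<le> n \<Longrightarrow> ksets n s \<noteq> {}"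
  using card_ksets[of n s] by (metis binomial_eq_0_iff card.empty not_less)

text \<open>The eigenvalue of the paper: \<open>walsh_mean n s B\<close> equals \<open>lam n (card B) s\<close>.\<close>

definition walsh_mean :: "nat \<Rightarrow> nat \<Rightarrow> nat set \<Rightarrow> real" where
  "walsh_mean n s B = (\<Sum>S\<in>ksets n s. walsh B S) / real (n choose s)"

lemma walsh_mean_empty: "s \<le> n \<Longrightarrow> walsh_mean n s {} = 1"
  by (simp add: walsh_mean_def)

text \<open>On sets of fixed size the characters of \<open>B\<close> and of its complement differ by
  a constant sign. This gives the coefficient of the full set and reduces complements of singletons
  to singletons.\<close>

lemma walsh_mean_compl:
  assumes "B \<subseteq> {..<n}"
  shows "walsh_mean n s ({..<n} - B) = (-1) ^ s * walsh_mean n s B"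
proof -
  have "(\<Sum>S\<in>ksets n s. walsh ({..<n} - B) S) = (\<Sum>S\<in>ksets n s. (-1) ^ s * walsh B S)"
    using assms by (intro sum.cong) (auto simp: walsh_compl ksets_def)
  then show ?thesis by (simp add: walsh_mean_def sum_distrib_left)
qed

lemma abs_walsh_mean_le_1: "\<bar>walsh_mean n s B\<bar> \<le> 1"
proof -
  have "\<bar>\<Sum>S\<in>ksets n s. walsh B S\<bar> \<le> (\<Sum>S\<in>ksets n s. \<bar>walsh B S\<bar>)" by (rule sum_abs)
  also have "\<dots> = n choose s" by simp
  finally show ?thesis by (simp add: walsh_mean_def divide_le_eq)
qed

text \<open>The family of \<open>s\<close>-subsets is invariant under permutations; one that carries
  \<open>B\<close> to \<open>B'\<close> is glued from a bijection of these sets and one of their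
  complements.\<close>

lemma walsh_mean_card_cong:
  assumes "B \<subseteq> {..<n}" "B' \<subseteq> {..<n}" "card B = card B'"
  shows "walsh_mean n s B = walsh_mean n s B'"
proof -
  have fin: "finite B" "finite B'" using assms finite_subset by blast+
  obtain f where f: "bij_betw f B B'" using finite_same_card_bij[OF fin assms(3)] by blast
  have "card ({..<n} - B) = card ({..<n} - B')"
    using assms fin by (simp add: card_Diff_subset)
  then obtain g where g: "bij_betw g ({..<n} - B) ({..<n} - B')"
    using finite_same_card_bij[of "{..<n} - B" "{..<n} - B'"] by auto
  define h where "h = (\<lambda>x. if x \<in> B then f x else g x)"
  have hB: "bij_betw h B B'" using f by (subst bij_betw_cong[of _ _ f]) (auto simp: h_def)
  have "bij_betw h ({..<n} - B) ({..<n} - B')" using g by (subst bij_betw_cong[of _ _ g]) (auto simp: h_def)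
  from bij_betw_combine[OF hB this] have h: "bij_betw h {..<n} {..<n}"
    using assms by (simp add: Un_absorb1 Diff_Int_distrib)
  have inj: "inj_on h {..<n}" using h by (rule bij_betw_imp_inj_on)
  have "bij_betw ((`) h) (ksets n s) (ksets n s)"
  proof (rule bij_betwI')
    fix X Y assume "X \<in> ksets n s" "Y \<in> ksets n s"
    then show "(h ` X = h ` Y) = (X = Y)" using inj_on_image_eq_iff[OF inj] by (auto simp: ksets_def)
  next
    fix X assume X: "X \<in> ksets n s"
    then have "card (h ` X) = s" 
      using card_image[OF inj_on_subset[OF inj]] by (auto simp: ksets_def)
    then show "h ` X \<in> ksets n s" using X h by (auto simp: ksets_def bij_betw_def)
  next
    fix Y assume Y: "Y \<in> ksets n s"
    then have "Y \<subseteq> h ` {..<n}" using h by (simp add: ksets_def bij_betw_def)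
    then obtain X where X: "X \<subseteq> {..<n}" "Y = h ` X" by (rule subset_imageE)
    then have "card Y = card X" using card_image[OF inj_on_subset[OF inj]] by auto
    then show "\<exists>X\<in>ksets n s. Y = h ` X" using X Y by (auto simp: ksets_def)
  qed
  then have "(\<Sum>S\<in>ksets n s. walsh B' S) = (\<Sum>S\<in>ksets n s. walsh B' (h ` S))"
    by (rule sum.reindex_bij_betw[symmetric])
  also have "\<dots> = (\<Sum>S\<in>ksets n s. walsh B S)"
  proof (intro sum.cong refl)
    fix S assume S: "S \<in> ksets n s"
    have "B' \<inter> h ` S = h ` (B \<inter> S)"
      using hB S assms inj_on_image_Int[OF inj, of B S] by (auto simp: bij_betw_def ksets_def)
    moreover have "inj_on h (B \<inter> S)" using inj assms by (auto intro: inj_on_subset)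
    ultimately show "walsh B' (h ` S) = walsh B S" by (simp add: walsh_def card_image)
  qed
  finally show ?thesis by (simp add: walsh_mean_def)
qed

text \<open>After expanding the square and summing over \<open>B\<close> first, orthogonality leaves
  only the diagonal.\<close>

lemma walsh_mean_plancherel:
  assumes "s \<le> n"
  shows "(\<Sum>B\<in>Pow {..<n}. (walsh_mean n s B)\<^sup>2) = 2 ^ n / real (n choose s)"
proof -
  have "(\<Sum>B\<in>Pow {..<n}. (\<Sum>S\<in>ksets n s. walsh B S)\<^sup>2)
        = (\<Sum>B\<in>Pow {..<n}. \<Sum>S\<in>ksets n s. \<Sum>S'\<in>ksets n s. walsh B S * walsh B S')"
    by (simp add: power2_eq_square sum_product)
  also have "\<dots> = (\<Sum>S\<in>ksets n s. \<Sum>B\<in>Pow {..<n}. \<Sum>S'\<in>ksets n s. walsh B S * walsh B S')"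
    by (rule sum.swap)
  also have "\<dots> = (\<Sum>S\<in>ksets n s. \<Sum>S'\<in>ksets n s. \<Sum>B\<in>Pow {..<n}. walsh B S * walsh B S')"
    by (intro sum.cong refl sum.swap)
  also have "\<dots> = (\<Sum>S\<in>ksets n s. \<Sum>S'\<in>ksets n s. if S = S' then 2 ^ n else 0)"
    by (intro sum.cong refl) (subst walsh_orthogonal, auto simp: ksets_def)
  also have "\<dots> = real (n choose s) * 2 ^ n" by (simp add: sum.delta)
  finally show ?thesis using assms
    by (simp add: walsh_mean_def power_divide sum_divide_distrib[symmetric] power2_eq_square)
qed

text \<open>All sets of the size of \<open>B\<close> contribute the same term to the Plancherel sum,
  and the other terms are nonnegative.\<close>

lemma walsh_mean_sq_le:
  assumes "s \<le> n" "B \<subseteq> {..<n}"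
  shows "real (n choose card B) * (walsh_mean n s B)\<^sup>2 \<le> 2 ^ n / real (n choose s)"
proof -
  have "real (n choose card B) * (walsh_mean n s B)\<^sup>2 = (\<Sum>B'\<in>ksets n (card B). (walsh_mean n s B)\<^sup>2)"
    by simp
  also have "\<dots> = (\<Sum>B'\<in>ksets n (card B). (walsh_mean n s B')\<^sup>2)"
    using assms by (intro sum.cong refl arg_cong[of _ _ "\<lambda>x. x\<^sup>2"] walsh_mean_card_cong) (auto simp: ksets_def)
  also have "\<dots> \<le> (\<Sum>B\<in>Pow {..<n}. (walsh_mean n s B)\<^sup>2)"
    by (intro sum_mono2) (auto simp: ksets_def)
  also have "\<dots> = 2 ^ n / real (n choose s)" by (rule walsh_mean_plancherel[OF assms(1)])
  finally show ?thesis .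
qed

text \<open>Average over all singletons: each \<open>s\<close>-subset contributes n - 2 s in total.
  The exact value serves where there are only n sets of the given size and the Plancherel bound is
  too crude.\<close>

lemma walsh_mean_singleton:
  assumes "s \<le> n" "j < n"
  shows "walsh_mean n s {j} = (real n - 2 * real s) / real n"
proof -
  have "real n * walsh_mean n s {j} = (\<Sum>i<n. walsh_mean n s {j})" by simp
  also have "\<dots> = (\<Sum>i<n. walsh_mean n s {i})"
    using assms by (intro sum.cong refl walsh_mean_card_cong) auto
  also have "\<dots> = (\<Sum>S\<in>ksets n s. \<Sum>i<n. walsh {i} S) / real (n choose s)"
    by (subst sum.swap) (simp add: walsh_mean_def sum_divide_distrib)
  also have "(\<Sum>S\<in>ksets n s. \<Sum>i<n. walsh {i} S) = (\<Sum>S\<in>ksets n s. real n - 2 * real s)"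
  proof (intro sum.cong refl)
    fix S assume "S \<in> ksets n s"
    then have S: "S \<subseteq> {..<n}" "card S = s" by (auto simp: ksets_def)
    have "(\<Sum>i<n. walsh {i} S) = (\<Sum>i<n. 1 - 2 * (if i \<in> S then 1 else 0))"
      by (intro sum.cong refl) (simp add: walsh_eq_prod)
    also have "\<dots> = real n - 2 * real (card ({..<n} \<inter> S))"
      by (simp add: sum_subtractf sum_distrib_left[symmetric] sum.If_cases)
    also have "{..<n} \<inter> S = S" using S by auto
    finally show "(\<Sum>i<n. walsh {i} S) = real n - 2 * real s" using S by simp
  qed
  finally have "real n * walsh_mean n s {j} = real n - 2 * real s" using assms by simp
  then show ?thesis using assms by (simp add: field_simps)
qed

section \<open>Fourier inversion for the final configuration\<close>

text \<open>The symmetric difference of the chosen sets. The set itself is kept, not only its size,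
  because characters are multiplicative on it.\<close>

definition lb_final :: "nat \<Rightarrow> (nat \<Rightarrow> nat set) \<Rightarrow> nat set" where
  "lb_final n S = {j. j < n \<and> odd (card {r \<in> {1..n}. j \<in> S r})}"

lemma walsh_lb_final:
  assumes "B \<subseteq> {..<n}"
  shows "walsh B (lb_final n S) = (\<Prod>r=1..n. walsh B (S r))"
proof -
  have fin: "finite B" using assms finite_subset by blast
  have "walsh B (lb_final n S) = (\<Prod>j\<in>B. (-1) ^ card {r \<in> {1..n}. j \<in> S r})"
    unfolding walsh_eq_prod[OF fin] using assms
    by (intro prod.cong refl) (auto simp: lb_final_def)
  also have "\<dots> = (\<Prod>j\<in>B. \<Prod>r=1..n. if j \<in> S r then -1 else 1)"
    by (simp add: prod.If_cases Int_def)
  also have "\<dots> = (\<Prod>r=1..n. \<Prod>j\<in>B. if j \<in> S r then -1 else 1)" by (rule prod.swap)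
  finally show ?thesis by (simp add: walsh_eq_prod[OF fin])
qed

text \<open>The value {} outside the stages is the default value of the function space, which makes
  the outcomes a finite product.\<close>

lemma lb_outcomes_eq: "lb_outcomes n n (\<lambda>r. r) = PiE_dflt {1..n} {} (ksets n)"
  by (auto simp: lb_outcomes_def PiE_dflt_def ksets_def)

text \<open>Restriction to \<open>A\<close> is a bijection onto the extensional product, where
  product and sum exchange.\<close>

lemma sum_prod_PiE_dflt:
  fixes f :: "'a \<Rightarrow> 'b \<Rightarrow> real"
  assumes "finite A" "\<And>x. x \<in> A \<Longrightarrow> finite (B x)"
  shows "(\<Sum>g\<in>PiE_dflt A d B. \<Prod>x\<in>A. f x (g x)) = (\<Prod>x\<in>A. \<Sum>y\<in>B x. f x y)"
proof -
  have "(\<Prod>x\<in>A. \<Sum>y\<in>B x. f x y) = (\<Sum>g\<in>PiE A B. \<Prod>x\<in>A. f x (g x))"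
    using assms by (rule prod_sum_PiE)
  also have "\<dots> = (\<Sum>g\<in>(\<lambda>h. restrict h A) ` PiE_dflt A d B. \<Prod>x\<in>A. f x (g x))"
    by (simp add: restrict_PiE_dflt)
  also have "\<dots> = (\<Sum>g\<in>PiE_dflt A d B. \<Prod>x\<in>A. f x (g x))"
    by (subst sum.reindex)
       (auto simp: inj_on_def restrict_def fun_eq_iff PiE_dflt_def, metis)
  finally show ?thesis by simp
qed

text \<open>Independence of the stages: the expectation of a product of one character per stage
  factorises.\<close>

lemma sum_walsh_lb_final:
  assumes "B \<subseteq> {..<n}"
  shows "(\<Sum>S\<in>lb_outcomes n n (\<lambda>r. r). walsh B (lb_final n S)) / real (card (lb_outcomes n n (\<lambda>r. r)))
         = (\<Prod>r=1..n. walsh_mean n r B)"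
proof -
  have "(\<Sum>S\<in>lb_outcomes n n (\<lambda>r. r). walsh B (lb_final n S)) = (\<Prod>r=1..n. \<Sum>S\<in>ksets n r. walsh B S)"
    unfolding lb_outcomes_eq walsh_lb_final[OF assms] by (rule sum_prod_PiE_dflt) auto
  moreover have "card (lb_outcomes n n (\<lambda>r. r)) = (\<Prod>r=1..n. n choose r)"
    unfolding lb_outcomes_eq by (subst card_PiE_dflt) auto
  ultimately show ?thesis by (simp add: walsh_mean_def prod_dividef)
qed

text \<open>Fourier inversion: orthogonality writes the indicator of the event as a combination of
  characters, whose expectations are the products of Walsh means.\<close>

lemma prob_lb_final:
  "measure_pmf.prob (std_lb_pmf n) {S. Q (lb_final n S)}
    = (\<Sum>A | A \<subseteq> {..<n} \<and> Q A. \<Sum>B\<in>Pow {..<n}. walsh B A * (\<Prod>r=1..n. walsh_mean n r B)) / 2 ^ n"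
proof -
  define \<Omega> where "\<Omega> = lb_outcomes n n (\<lambda>r. r)"
  have fin: "finite \<Omega>" unfolding \<Omega>_def lb_outcomes_eq by auto
  have ne: "\<Omega> \<noteq> {}" unfolding \<Omega>_def lb_outcomes_eq by (auto dest: ksets_nonempty)
  have finQ: "finite {A. A \<subseteq> {..<n} \<and> Q A}" by (rule finite_subset[of _ "Pow {..<n}"]) auto
  have ind: "(if Q (lb_final n S) then 1 else 0)
      = (\<Sum>A | A \<subseteq> {..<n} \<and> Q A. \<Sum>B\<in>Pow {..<n}. walsh B A * walsh B (lb_final n S)) / 2 ^ n" for S
  proof -
    have sub: "lb_final n S \<subseteq> {..<n}" by (auto simp: lb_final_def)
    have "(\<Sum>A | A \<subseteq> {..<n} \<and> Q A. \<Sum>B\<in>Pow {..<n}. walsh B A * walsh B (lb_final n S))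
          = (\<Sum>A | A \<subseteq> {..<n} \<and> Q A. if A = lb_final n S then 2 ^ n else 0)"
      using sub by (intro sum.cong refl) (subst walsh_orthogonal, auto)
    also have "\<dots> = (if Q (lb_final n S) then 2 ^ n else 0)"
      using sub finQ by (simp add: sum.delta')
    finally show ?thesis by simp
  qed
  have "measure_pmf.prob (std_lb_pmf n) {S. Q (lb_final n S)} = real (card (\<Omega> \<inter> {S. Q (lb_final n S)})) / card \<Omega>"
    unfolding std_lb_pmf_def lb_pmf_def \<Omega>_def[symmetric] by (rule measure_pmf_of_set[OF ne fin])
  also have "real (card (\<Omega> \<inter> {S. Q (lb_final n S)})) = (\<Sum>S\<in>\<Omega>. if Q (lb_final n S) then 1 else 0)"
    using fin by (simp add: sum.If_cases)
  also have "\<dots> / card \<Omega> = (\<Sum>S\<in>\<Omega>. \<Sum>A | A \<subseteq> {..<n} \<and> Q A. \<Sum>B\<in>Pow {..<n}. walsh B A * walsh B (lb_final n S)) / 2 ^ n / card \<Omega>"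
    unfolding ind by (simp add: sum_divide_distrib)
  also have "(\<Sum>S\<in>\<Omega>. \<Sum>A | A \<subseteq> {..<n} \<and> Q A. \<Sum>B\<in>Pow {..<n}. walsh B A * walsh B (lb_final n S))
      = (\<Sum>A | A \<subseteq> {..<n} \<and> Q A. \<Sum>S\<in>\<Omega>. \<Sum>B\<in>Pow {..<n}. walsh B A * walsh B (lb_final n S))"
    by (rule sum.swap)
  also have "\<dots> = (\<Sum>A | A \<subseteq> {..<n} \<and> Q A. \<Sum>B\<in>Pow {..<n}. walsh B A * (\<Sum>S\<in>\<Omega>. walsh B (lb_final n S)))"
    by (subst sum.swap) (simp add: sum_distrib_left)
  also have "\<dots> / 2 ^ n / card \<Omega> = (\<Sum>A | A \<subseteq> {..<n} \<and> Q A. \<Sum>B\<in>Pow {..<n}. walsh B A * ((\<Sum>S\<in>\<Omega>. walsh B (lb_final n S)) / card \<Omega>)) / 2 ^ n"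
    unfolding times_divide_eq_right sum_divide_distrib[symmetric] by (simp add: mult.commute)
  also have "\<dots> = (\<Sum>A | A \<subseteq> {..<n} \<and> Q A. \<Sum>B\<in>Pow {..<n}. walsh B A * (\<Prod>r=1..n. walsh_mean n r B)) / 2 ^ n"
    unfolding \<Omega>_def by (intro sum.cong refl arg_cong2[of _ _ _ _ "(/)"] arg_cong2[of _ _ _ _ "(*)"] sum_walsh_lb_final) auto
  finally show ?thesis .
qed

text \<open>The empty set contributes 1 and the full set (-1)^(card A + p), with \<open>p\<close>
  the total number of switches; together they yield the uniform law on configurations of the parity
  of \<open>p\<close>. For the other characters the triangle inequality suffices, as at most 2^n
  sets \<open>A\<close> meet the factor 1 / 2^n.\<close>

lemma prob_lb_final_approx:
  assumes "n > 0"
  defines "p \<equiv> \<Sum>{1..n}"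
  shows "\<bar>measure_pmf.prob (std_lb_pmf n) {S. Q (lb_final n S)}
           - real (card {A. A \<subseteq> {..<n} \<and> Q A \<and> even (card A + p)}) / 2 ^ (n - 1)\<bar>
         \<le> (\<Sum>B\<in>Pow {..<n} - {{}, {..<n}}. \<bar>\<Prod>r=1..n. walsh_mean n r B\<bar>)"
proof -
  define V where "V = {..<n}"
  define M where "M = (\<lambda>B. \<Prod>r=1..n. walsh_mean n r B)"
  define QQ where "QQ = {A. A \<subseteq> V \<and> Q A}"
  have finQ: "finite QQ" unfolding QQ_def V_def by (rule finite_subset[of _ "Pow {..<n}"]) auto
  have V: "{} \<noteq> V" "finite V" using assms by (auto simp: V_def)
  have M0: "M {} = 1" by (simp add: M_def walsh_mean_empty)
  \<comment> \<open>The full set is the complement of {}, so stage r contributes the sign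
    (-1)^r.\<close>
  have "M V = (\<Prod>r=1..n. (-1) ^ r * walsh_mean n r {})"
    unfolding M_def using walsh_mean_compl[of "{}" n] by (simp add: V_def)
  also have "\<dots> = (-1) ^ p" by (simp add: walsh_mean_empty p_def power_sum[symmetric])
  finally have MV: "M V = (-1) ^ p" .
  have split: "(\<Sum>B\<in>Pow V. walsh B A * M B) = 1 + (-1) ^ (card A + p) + (\<Sum>B\<in>Pow V - {{}, V}. walsh B A * M B)"
    if "A \<subseteq> V" for A
  proof -
    have "V \<inter> A = A" using that by auto
    then have "(\<Sum>B\<in>{{}, V}. walsh B A * M B) = 1 + (-1) ^ (card A + p)"
      using V by (simp add: M0 MV power_add) (simp add: walsh_def)
    moreover have "(\<Sum>B\<in>Pow V. walsh B A * M B) = (\<Sum>B\<in>Pow V - {{}, V}. walsh B A * M B) + (\<Sum>B\<in>{{}, V}. walsh B A * M B)"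
      using V by (intro sum.subset_diff) auto
    ultimately show ?thesis by simp
  qed
  have par: "(\<Sum>A\<in>QQ. 1 + (-1) ^ (card A + p)) = 2 * real (card {A. A \<subseteq> V \<and> Q A \<and> even (card A + p)})"
  proof -
    have "(\<Sum>A\<in>QQ. 1 + (-1) ^ (card A + p)) = (\<Sum>A\<in>QQ. if even (card A + p) then 2 else (0::real))"
      by (intro sum.cong) auto
    also have "\<dots> = 2 * real (card (QQ \<inter> {A. even (card A + p)}))"
      using finQ by (simp add: sum.If_cases)
    also have "QQ \<inter> {A. even (card A + p)} = {A. A \<subseteq> V \<and> Q A \<and> even (card A + p)}" by (auto simp: QQ_def)
    finally show ?thesis .
  qed
  have "measure_pmf.prob (std_lb_pmf n) {S. Q (lb_final n S)} = (\<Sum>A\<in>QQ. \<Sum>B\<in>Pow V. walsh B A * M B) / 2 ^ n"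
    unfolding prob_lb_final by (simp add: QQ_def V_def M_def)
  also have "(\<Sum>A\<in>QQ. \<Sum>B\<in>Pow V. walsh B A * M B)
     = (\<Sum>A\<in>QQ. 1 + (-1) ^ (card A + p) + (\<Sum>B\<in>Pow V - {{}, V}. walsh B A * M B))"
    by (intro sum.cong refl split) (auto simp: QQ_def)
  also have "\<dots> = 2 * real (card {A. A \<subseteq> V \<and> Q A \<and> even (card A + p)})
                 + (\<Sum>A\<in>QQ. \<Sum>B\<in>Pow V - {{}, V}. walsh B A * M B)"
    by (subst sum.distrib) (simp only: par)
  finally have "measure_pmf.prob (std_lb_pmf n) {S. Q (lb_final n S)}
      - 2 * real (card {A. A \<subseteq> V \<and> Q A \<and> even (card A + p)}) / 2 ^ n
      = (\<Sum>A\<in>QQ. \<Sum>B\<in>Pow V - {{}, V}. walsh B A * M B) / 2 ^ n"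
    by (simp add: add_divide_distrib)
  moreover have "\<bar>\<Sum>A\<in>QQ. \<Sum>B\<in>Pow V - {{}, V}. walsh B A * M B\<bar> \<le> 2 ^ n * (\<Sum>B\<in>Pow V - {{}, V}. \<bar>M B\<bar>)"
  proof -
    have "\<bar>\<Sum>A\<in>QQ. \<Sum>B\<in>Pow V - {{}, V}. walsh B A * M B\<bar> \<le> (\<Sum>A\<in>QQ. \<bar>\<Sum>B\<in>Pow V - {{}, V}. walsh B A * M B\<bar>)"
      by (rule sum_abs)
    also have "\<dots> \<le> (\<Sum>A\<in>QQ. \<Sum>B\<in>Pow V - {{}, V}. \<bar>M B\<bar>)"
      by (intro sum_mono order_trans[OF sum_abs]) (simp add: abs_mult)
    also have "\<dots> = real (card QQ) * (\<Sum>B\<in>Pow V - {{}, V}. \<bar>M B\<bar>)" by simp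
    also have "card QQ \<le> card (Pow V)" using V by (intro card_mono) (auto simp: QQ_def)
    then have "real (card QQ) \<le> 2 ^ n" using V by (simp add: card_Pow V_def)
    then have "real (card QQ) * (\<Sum>B\<in>Pow V - {{}, V}. \<bar>M B\<bar>) \<le> 2 ^ n * (\<Sum>B\<in>Pow V - {{}, V}. \<bar>M B\<bar>)"
      by (intro mult_right_mono sum_nonneg) auto
    finally show ?thesis .
  qed
  moreover have "2 * x / 2 ^ n = x / 2 ^ (n - 1)" for x :: real
    using assms by (cases n) auto
  ultimately show ?thesis unfolding M_def V_def by (simp add: divide_le_eq mult.commute)
qed

section \<open>Decay of the nontrivial Walsh coefficients\<close>

text \<open>Consecutive coefficients have ratio (n - s) / (s + 1), which in this range is at least
  124/133 > 93/100.\<close>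

lemma middle_binomial_ge:
  fixes n j :: nat
  assumes "n \<ge> 256" "j \<le> 5"
  shows "(93/100) ^ j * real (n choose (n div 2)) \<le> real (n choose (n div 2 + j))"
  using \<open>j \<le> 5\<close>
proof (induction j)
  case (Suc j)
  define s where "s = n div 2 + j"
  have "Suc s * (n choose Suc s) = (n - s) * (n choose s)"
    using binomial_absorption[of s n] binomial_absorb_comp[of n s] by simp
  then have eq: "real (Suc s) * real (n choose Suc s) = real (n - s) * real (n choose s)"
    by (metis of_nat_mult)
  have h: "n div 2 \<ge> 128" "2 * (n div 2) \<le> n" using assms by auto
  then have "real (n div 2) \<ge> 128" "2 * real (n div 2) \<le> real n" by linarith+
  moreover have "real (n - s) = real n - real (n div 2) - real j" "real j \<le> 4"
    using h Suc.prems by (simp_all add: s_def)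
  ultimately have "93/100 * real (Suc s) \<le> real (n - s)" by (simp add: s_def)
  then have "(93/100 * real (Suc s)) * real (n choose s) \<le> real (Suc s) * real (n choose Suc s)"
    unfolding eq by (intro mult_right_mono) auto
  then have "real (Suc s) * (93/100 * real (n choose s)) \<le> real (Suc s) * real (n choose Suc s)"
    by (simp only: mult_ac)
  then have "93/100 * real (n choose s) \<le> real (n choose Suc s)"
    by (rule mult_left_le_imp_le) simp
  then show ?case using Suc by (simp add: s_def)
qed simp

text \<open>The central coefficient is at least 2^n / (n + 1), and five steps away cost at most a
  factor 1/2, since (93/100)^5 > 1/2.\<close>

lemma middle_binomial_lower_bound:
  fixes n s :: nat
  assumes "n \<ge> 256" "n div 2 \<le> s + 4" "s \<le> n div 2 + 5"
  shows "2 ^ n / real (n choose s) \<le> 2 * (real n + 1)"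
proof -
  have upper: "2 ^ n / real (n choose (n div 2 + j)) \<le> 2 * (real n + 1)" if "j \<le> 5" for j
  proof -
    have "(2::nat) ^ n = (\<Sum>k\<le>n. n choose k)" by (rule choose_row_sum[symmetric])
    also have "\<dots> \<le> of_nat (card {..n}) * (n choose (n div 2))"
      by (intro sum_bounded_above binomial_maximum)
    finally have "real (2 ^ n) \<le> real ((n + 1) * (n choose (n div 2)))" by (intro of_nat_mono) simp
    then have 1: "2 ^ n \<le> (real n + 1) * real (n choose (n div 2))" by (simp add: algebra_simps)
    have "(93/100) ^ 5 \<le> (93/100 :: real) ^ j" using that by (intro power_decreasing) auto
    then have "1/2 \<le> (93/100 :: real) ^ j" by (simp add: power_numeral_reduce)
    then have "1/2 * real (n choose (n div 2)) \<le> (93/100) ^ j * real (n choose (n div 2))"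
      by (intro mult_right_mono) auto
    also have "\<dots> \<le> real (n choose (n div 2 + j))" by (rule middle_binomial_ge[OF assms(1) that])
    finally have "real (n choose (n div 2)) \<le> 2 * real (n choose (n div 2 + j))" by simp
    then have "(real n + 1) * real (n choose (n div 2)) \<le> (real n + 1) * (2 * real (n choose (n div 2 + j)))"
      by (intro mult_left_mono) auto
    moreover have "real (n choose (n div 2 + j)) > 0" using assms that by (simp add: zero_less_binomial_iff)
    ultimately show ?thesis using 1 by (simp add: divide_le_eq algebra_simps)
  qed
  show ?thesis
  proof (cases "s \<ge> n div 2")
    case True
    then show ?thesis using upper[of "s - n div 2"] assms by simp
  next
    case False
    \<comment> \<open>Reflection to n - s lands one step further out when \<open>n\<close> is odd;
      hence four steps below the middle but five above.\<close>
    then have "n choose s = n choose (n div 2 + (n - s - n div 2))"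
      by (subst binomial_symmetric) (auto intro!: arg_cong[of _ _ "(choose) n"])
    moreover have "n - s - n div 2 \<le> 5" using assms by linarith
    ultimately show ?thesis using upper[of "n - s - n div 2"] by metis
  qed
qed

lemma abs_prod_walsh_mean_le:
  assumes "I \<subseteq> {1..n}"
  shows "\<bar>\<Prod>r=1..n. walsh_mean n r B\<bar> \<le> (\<Prod>r\<in>I. \<bar>walsh_mean n r B\<bar>)"
proof -
  have "\<bar>\<Prod>r=1..n. walsh_mean n r B\<bar>
      = (\<Prod>r\<in>{1..n} - I. \<bar>walsh_mean n r B\<bar>) * (\<Prod>r\<in>I. \<bar>walsh_mean n r B\<bar>)"
    unfolding abs_prod using assms by (intro prod.subset_diff) auto
  also have "\<dots> \<le> 1 * (\<Prod>r\<in>I. \<bar>walsh_mean n r B\<bar>)"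
    by (intro mult_right_mono prod_le_1 prod_nonneg) (auto simp: abs_walsh_mean_le_1)
  finally show ?thesis by simp
qed

lemma binomial_ge_choose_two:
  assumes "2 \<le> b" "b + 2 \<le> n"
  shows "n choose 2 \<le> n choose b"
proof (cases "2 * b \<le> n")
  case True
  then show ?thesis using assms by (intro binomial_mono) auto
next
  case False
  have "n choose 2 \<le> n choose (n - b)" using assms False by (intro binomial_mono) auto
  then show ?thesis using binomial_symmetric[of b n] assms by simp
qed

text \<open>By Plancherel each of ten middle factors has square at most \<open>R / C\<close>, so
  their product is at most (R / C)^5. What remains is R^5 / C^4, of order n^(-3) because
  \<open>C\<close> is at least of order n^2.\<close>

lemma prod_walsh_mean_generic:
  assumes "n \<ge> 256" "B \<subseteq> {..<n}" "2 \<le> card B" "card B + 2 \<le> n"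
  shows "real (n choose card B) * \<bar>\<Prod>r=1..n. walsh_mean n r B\<bar> \<le> 4 / (real n)\<^sup>2"
proof -
  define C where "C = real (n choose card B)"
  define R where "R = 2 * (real n + 1)"
  define I where "I = {n div 2 - 4..n div 2 + 5}"
  have I: "I \<subseteq> {1..n}" "card I = 10" using assms by (auto simp: I_def)
  have "real (n choose 2) \<le> C" unfolding C_def using binomial_ge_choose_two[OF assms(3,4)] by simp
  moreover have "2 * (n choose 2) = n * (n - 1)"
    using binomial_absorption[of 1 n] by (simp add: numeral_2_eq_2)
  then have "2 * real (n choose 2) = real n * (real n - 1)"
    using assms(1) by (metis of_nat_1 of_nat_diff of_nat_mult of_nat_numeral one_le_numeral order_trans)
  ultimately have C: "real n * (real n - 1) / 2 \<le> C" by linarith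
  have np: "real n * (real n - 1) > 0" using assms(1) by simp
  then have Cpos: "C > 0" using C by linarith
  have mid: "(walsh_mean n r B)\<^sup>2 \<le> R / C" if "r \<in> I" for r
  proof -
    have "C * (walsh_mean n r B)\<^sup>2 \<le> 2 ^ n / real (n choose r)"
      unfolding C_def using that I by (intro walsh_mean_sq_le assms) auto
    also have "\<dots> \<le> R" unfolding R_def
      using that assms(1) by (intro middle_binomial_lower_bound) (auto simp: I_def)
    finally show ?thesis using Cpos by (simp add: field_simps)
  qed
  \<comment> \<open>Comparing squares avoids roots of \<open>R / C\<close>.\<close>
  have "(C * \<bar>\<Prod>r=1..n. walsh_mean n r B\<bar>)\<^sup>2 \<le> C\<^sup>2 * (\<Prod>r\<in>I. \<bar>walsh_mean n r B\<bar>)\<^sup>2"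
    unfolding power_mult_distrib
    by (intro mult_left_mono power_mono abs_prod_walsh_mean_le I) auto
  also have "(\<Prod>r\<in>I. \<bar>walsh_mean n r B\<bar>)\<^sup>2 = (\<Prod>r\<in>I. (walsh_mean n r B)\<^sup>2)"
    by (simp add: prod_power_distrib)
  also have "(\<Prod>r\<in>I. (walsh_mean n r B)\<^sup>2) \<le> (\<Prod>r\<in>I. R / C)"
    using mid by (intro prod_mono) auto
  also have "C\<^sup>2 * (\<Prod>r\<in>I. R / C) = (R ^ 5 / C ^ 4)\<^sup>2"
    using Cpos by (simp add: I power_divide field_simps power_numeral_reduce)
  finally have "C * \<bar>\<Prod>r=1..n. walsh_mean n r B\<bar> \<le> R ^ 5 / C ^ 4"
    by (rule power2_le_imp_le) (use Cpos in \<open>auto simp: R_def\<close>)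
  also have "\<dots> \<le> 4 / (real n)\<^sup>2"
  proof -
    define N where "N = real n"
    have N: "N \<ge> 256" using assms(1) by (simp add: N_def)
    \<comment> \<open>The constant 257/255 is the value of (N + 1) / (N - 1) at N = 256, and its
      fourth power is below 5/4.\<close>
    have "(N + 1) ^ 4 \<le> (257/255 * (N - 1)) ^ 4" using N by (intro power_mono) auto
    also have "\<dots> = (257/255) ^ 4 * (N - 1) ^ 4" by (simp only: power_mult_distrib)
    also have "\<dots> \<le> 5/4 * (N - 1) ^ 4"
      using N by (intro mult_right_mono) (auto simp: power_numeral_reduce)
    finally have "128 * (N + 1) * (N + 1) ^ 4 \<le> 128 * (N + 1) * (5/4 * (N - 1) ^ 4)"
      using N by (intro mult_left_mono) auto
    also have "\<dots> = (160 * N + 160) * (N - 1) ^ 4" by simp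
    also have "\<dots> \<le> N\<^sup>2 * (N - 1) ^ 4"
    proof (intro mult_right_mono)
      have "N * N \<ge> 256 * N" using N by (intro mult_right_mono) auto
      then show "160 * N + 160 \<le> N\<^sup>2" using N unfolding power2_eq_square by linarith
    qed auto
    finally have *: "128 * (N + 1) ^ 5 \<le> N\<^sup>2 * (N - 1) ^ 4" by (simp add: power_numeral_reduce mult_ac)
    have "R ^ 5 * N\<^sup>2 = 32 * (N + 1) ^ 5 * N\<^sup>2" unfolding R_def N_def[symmetric] power_mult_distrib by simp
    also have "\<dots> \<le> (N\<^sup>2 * (N - 1) ^ 4 / 4) * N\<^sup>2" using * by (intro mult_right_mono) auto
    also have "\<dots> = 4 * (N * (N - 1) / 2) ^ 4"
      by (simp add: power_mult_distrib power_divide power_numeral_reduce)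
    also have "\<dots> \<le> 4 * C ^ 4"
      using C np unfolding N_def by (intro mult_left_mono power_mono) auto
    finally have "R ^ 5 * N\<^sup>2 \<le> 4 * C ^ 4" .
    then show ?thesis using Cpos N unfolding N_def[symmetric] by (simp add: field_simps)
  qed
  finally show ?thesis by (simp add: C_def)
qed

text \<open>Four stages next to n / 2 have |n - 2 r| \<le> 4, which gives n (4 / n)^4 = 256 /
  n^3.\<close>

lemma prod_walsh_mean_singleton:
  assumes "n \<ge> 256" "j < n"
  shows "real n * \<bar>\<Prod>r=1..n. walsh_mean n r {j}\<bar> \<le> 4 / (real n)\<^sup>2"
proof -
  define I where "I = {n div 2 - 1..n div 2 + 2}"
  have I: "I \<subseteq> {1..n}" "card I = 4" using assms by (auto simp: I_def)
  have "\<bar>walsh_mean n r {j}\<bar> \<le> 4 / real n" if "r \<in> I" for r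
  proof -
    have "r \<le> n" using that I by auto
    then have "\<bar>walsh_mean n r {j}\<bar> = \<bar>real n - 2 * real r\<bar> / real n"
      using assms by (simp add: walsh_mean_singleton)
    moreover have "\<bar>real n - 2 * real r\<bar> \<le> 4" using that assms unfolding I_def by auto
    ultimately show ?thesis by (simp add: divide_right_mono)
  qed
  then have "(\<Prod>r\<in>I. \<bar>walsh_mean n r {j}\<bar>) \<le> (\<Prod>r\<in>I. 4 / real n)" by (intro prod_mono) auto
  then have "\<bar>\<Prod>r=1..n. walsh_mean n r {j}\<bar> \<le> (4 / real n) ^ 4"
    using abs_prod_walsh_mean_le[OF I(1), of "{j}"] I(2) by simp
  then have "real n * \<bar>\<Prod>r=1..n. walsh_mean n r {j}\<bar> \<le> real n * (4 / real n) ^ 4"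
    by (intro mult_left_mono) auto
  also have "\<dots> = 256 / real n * (1 / (real n)\<^sup>2)"
    using assms by (simp add: power_divide power_numeral_reduce)
  also have "\<dots> \<le> 4 * (1 / (real n)\<^sup>2)"
    using assms by (intro mult_right_mono) (auto simp: divide_le_eq)
  finally show ?thesis by simp
qed

lemma prod_walsh_mean_bound:
  assumes "n \<ge> 256" "B \<subseteq> {..<n}" "B \<noteq> {}" "B \<noteq> {..<n}"
  shows "real (n choose card B) * \<bar>\<Prod>r=1..n. walsh_mean n r B\<bar> \<le> 4 / (real n)\<^sup>2"
proof -
  have fin: "finite B" using assms finite_subset by blast
  have "card B > 0" using fin assms by (simp add: card_gt_0_iff)
  moreover have "card B < n" using psubset_card_mono[of "{..<n}" B] assms by auto
  ultimately consider "card B = 1" | "card B = n - 1" | "2 \<le> card B" "card B + 2 \<le> n" by linarith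
  then show ?thesis
  proof cases
    case 1
    then obtain j where "B = {j}" by (rule card_1_singletonE)
    then show ?thesis using prod_walsh_mean_singleton[of n j] assms by simp
  next
    case 2
    have "card ({..<n} - B) = 1" using 2 assms fin by (simp add: card_Diff_subset)
    then obtain j where j: "{..<n} - B = {j}" by (rule card_1_singletonE)
    then have "j < n" by auto
    have "walsh_mean n r {j} = (-1) ^ r * walsh_mean n r B" for r
      using walsh_mean_compl[OF assms(2), of r] j by simp
    then have "\<bar>\<Prod>r=1..n. walsh_mean n r {j}\<bar> = \<bar>\<Prod>r=1..n. walsh_mean n r B\<bar>"
      unfolding abs_prod by (simp add: abs_mult power_abs)
    moreover have "n choose card B = n"
      using binomial_symmetric[of "n - 1" n] 2 assms(1) by simp
    ultimately show ?thesis using prod_walsh_mean_singleton[of n j] assms(1) \<open>j < n\<close> by simp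
  next
    case 3
    then show ?thesis by (intro prod_walsh_mean_generic assms)
  qed
qed

text \<open>Grouped by cardinality, each of the n + 1 sizes contributes exactly 1.\<close>

lemma sum_inverse_binomial_card:
  "(\<Sum>B\<in>Pow {..<n}. 1 / real (n choose card B)) = real n + 1"
proof -
  have "(\<Sum>B\<in>Pow {..<n}. 1 / real (n choose card B))
      = (\<Sum>k\<le>n. \<Sum>B | B \<in> Pow {..<n} \<and> card B = k. 1 / real (n choose card B))"
    by (rule sum.group[symmetric]) (auto intro: order_trans[OF card_mono[of "{..<n}"]])
  also have "\<dots> = (\<Sum>k\<le>n. \<Sum>B\<in>ksets n k. 1 / real (n choose k))"
    by (intro sum.cong refl) (auto simp: ksets_def)
  also have "\<dots> = (\<Sum>k\<le>n. 1)" by (intro sum.cong refl) simp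
  finally show ?thesis by simp
qed

text \<open>The reciprocal binomial weights sum to 4 (n + 1) / n^2 \<le> 8 / n, and sqrt n \<ge> 16
  absorbs the 8.\<close>

lemma sum_prod_walsh_mean_bound:
  assumes "n \<ge> 256"
  shows "(\<Sum>B\<in>Pow {..<n} - {{}, {..<n}}. \<bar>\<Prod>r=1..n. walsh_mean n r B\<bar>) \<le> 1 / sqrt n"
proof -
  have pos: "real (n choose card B) > 0" if "B \<subseteq> {..<n}" for B
    using card_mono[OF _ that] by (simp add: zero_less_binomial_iff)
  have "(\<Sum>B\<in>Pow {..<n} - {{}, {..<n}}. \<bar>\<Prod>r=1..n. walsh_mean n r B\<bar>)
      \<le> (\<Sum>B\<in>Pow {..<n} - {{}, {..<n}}. 4 / (real n)\<^sup>2 * (1 / real (n choose card B)))"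
  proof (intro sum_mono)
    fix B assume "B \<in> Pow {..<n} - {{}, {..<n}}"
    then show "\<bar>\<Prod>r=1..n. walsh_mean n r B\<bar> \<le> 4 / (real n)\<^sup>2 * (1 / real (n choose card B))"
      using prod_walsh_mean_bound[OF assms, of B] pos[of B]
      unfolding times_divide_eq_right mult_1_right by (subst pos_le_divide_eq) (auto simp: mult.commute)
  qed
  also have "\<dots> \<le> (\<Sum>B\<in>Pow {..<n}. 4 / (real n)\<^sup>2 * (1 / real (n choose card B)))"
    by (intro sum_mono2) auto
  also have "\<dots> = 4 / (real n)\<^sup>2 * (real n + 1)"
    unfolding sum_distrib_left[symmetric] sum_inverse_binomial_card ..
  also have "\<dots> \<le> 4 / (real n)\<^sup>2 * (2 * real n)" using assms by (intro mult_left_mono) auto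
  also have "\<dots> = 8 / (sqrt n * sqrt n)" using assms by (simp add: power2_eq_square)
  also have "\<dots> = 8 / sqrt n * (1 / sqrt n)" by simp
  also have "\<dots> \<le> 1 * (1 / sqrt n)"
  proof (intro mult_right_mono)
    have "sqrt n \<ge> 16" using assms by (intro real_le_rsqrt) auto
    then show "8 / sqrt n \<le> 1" by (simp add: divide_le_eq)
  qed auto
  finally show ?thesis by simp
qed

section \<open>Parity-restricted binomial sums and the approximation for large n\<close>

lemma sum_binomial_parity:
  assumes "n > 0"
  shows "(\<Sum>k\<le>K. if even (k + p) then n choose k else 0)
         = (\<Sum>k < (if even (K + p) then Suc K else K). (n - 1) choose k)"
proof (induction K)
  case (Suc K)
  obtain N where "n = Suc N" using assms by (cases n) auto
  then show ?case using Suc by (auto split: if_splits)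
qed (use assms in auto)

lemma card_parity_subsets:
  "card {A. A \<subseteq> {..<n} \<and> card A \<le> K \<and> even (card A + p)} = (\<Sum>k\<le>K. if even (k + p) then n choose k else 0)"
proof -
  define X where "X = {A. A \<subseteq> {..<n} \<and> card A \<le> K \<and> even (card A + p)}"
  have fin: "finite X" unfolding X_def by (rule finite_subset[of _ "Pow {..<n}"]) auto
  have "card X = (\<Sum>A\<in>X. 1)" by simp
  also have "\<dots> = (\<Sum>k\<le>K. \<Sum>A | A \<in> X \<and> card A = k. 1)"
    by (rule sum.group[symmetric]) (use fin in \<open>auto simp: X_def\<close>)
  also have "\<dots> = (\<Sum>k\<le>K. if even (k + p) then n choose k else 0)"
  proof (intro sum.cong refl)
    fix k assume "k \<in> {..K}"
    then have "{A. A \<in> X \<and> card A = k} = (if even (k + p) then ksets n k else {})"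
      by (auto simp: X_def ksets_def)
    then show "(\<Sum>A | A \<in> X \<and> card A = k. 1) = (if even (k + p) then n choose k else 0)" by simp
  qed
  finally show ?thesis by (simp add: X_def)
qed

lemma lb_count_eq: "std_lb_X n S = card (lb_final n S)"
  by (simp add: std_lb_X_def lb_count_def lb_final_def)

text \<open>Errors in units of 1 / sqrt n: 1 for the nontrivial characters, 8 for the binomial, 2
  for moving the level to a lattice point and 1 for replacing \<sigma> by sqrt n / 2.\<close>

proposition lightbulb_normal_approx:
  fixes n :: nat and \<sigma> z :: real
  assumes n: "n \<ge> 256" and \<sigma>: "\<sigma> > 0" and scale: "\<bar>2 * \<sigma> / sqrt n - 1\<bar> \<le> 1 / n"
  shows "\<bar>measure_pmf.prob (std_lb_pmf n) {S. (real (std_lb_X n S) - real n / 2) / \<sigma> \<le> z} - std_normal_cdf z\<bar>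
         \<le> 16 / sqrt n"
proof -
  define a where "a = 2 * \<sigma> / sqrt n"
  define x where "x = real n / 2 + \<sigma> * z"
  define P where "P = measure_pmf.prob (std_lb_pmf n) {S. (real (std_lb_X n S) - real n / 2) / \<sigma> \<le> z}"
  have P: "P = measure_pmf.prob (std_lb_pmf n) {S. real (card (lb_final n S)) \<le> x}"
    unfolding P_def x_def lb_count_eq using \<sigma> by (simp add: pos_divide_le_eq algebra_simps)
  have sqn: "sqrt n \<ge> 16" "sqrt n * sqrt n = n" using n by (auto intro: real_le_rsqrt)
  have az: "a * z = (2 * x - n) / sqrt n" by (simp add: a_def x_def)
  have "1 / real n \<le> 1 / 256" using n by (simp add: field_simps)
  then have "a \<ge> 1/2" using scale unfolding a_def by linarith
  then have "max 1 (1 / a) \<le> 2" by (simp add: field_simps)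
  then have "\<bar>a - 1\<bar> * max 1 (1 / a) \<le> 1 / n * 2"
    using scale unfolding a_def by (intro mult_mono) auto
  also have "\<dots> = 2 / sqrt n * (1 / sqrt n)" by simp
  also have "\<dots> \<le> 1 * (1 / sqrt n)" using sqn(1) by (intro mult_right_mono) (auto simp: divide_le_eq)
  finally have 1: "\<bar>std_normal_cdf (a * z) - std_normal_cdf z\<bar> \<le> 1 / sqrt n"
    using std_normal_cdf_scale[of a z] \<open>a \<ge> 1/2\<close> by simp
  have "\<bar>P - std_normal_cdf (a * z)\<bar> \<le> 11 / sqrt n"
  \<comment> \<open>Negative levels are separate because \<open>nat\<close> truncates the floor at
    0; there the probability is 0 and the binomial bound is used at m = 0.\<close>
  proof (cases "x < 0")
    case True
    then have "{S. real (card (lb_final n S)) \<le> x} = {}" by auto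
    then have "P = 0" by (simp add: P)
    moreover have "std_normal_cdf (a * z) \<le> std_normal_cdf ((2 * real 0 - real n) / sqrt n)"
      unfolding az using True by (intro std_normal_cdf_mono divide_right_mono) auto
    moreover have "\<bar>0 - std_normal_cdf ((2 * real 0 - real n) / sqrt n)\<bar> \<le> 8 / sqrt n"
      using binomial_cdf_normal_approx[of n 0] n by simp
    moreover have "8 / sqrt n \<le> 11 / sqrt n" by (intro divide_right_mono) auto
    ultimately show ?thesis using std_normal_cdf_bounds(1)[of "a * z"] by linarith
  next
    case False
    define K where "K = nat \<lfloor>x\<rfloor>"
    define p where "p = \<Sum>{1..n}"
    \<comment> \<open>Parity leaves \<open>m\<close> equal to \<open>K\<close> or
      \<open>Suc K\<close>, hence within distance 1 of \<open>x\<close>.\<close>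
    define m where "m = (if even (K + p) then Suc K else K)"
    define q where "q = (\<Sum>k<m. real ((n - 1) choose k)) / 2 ^ (n - 1)"
    have K: "real K \<le> x" "x < real K + 1" using False by (simp_all add: K_def)
    have "real k \<le> x \<longleftrightarrow> k \<le> K" for k using K by linarith
    then have "P = measure_pmf.prob (std_lb_pmf n) {S. card (lb_final n S) \<le> K}" by (simp add: P)
    moreover have "real (card {A. A \<subseteq> {..<n} \<and> card A \<le> K \<and> even (card A + p)}) = (\<Sum>k<m. real ((n - 1) choose k))"
      unfolding card_parity_subsets m_def using sum_binomial_parity[of n p K] n by simp
    ultimately have "\<bar>P - q\<bar> \<le> 1 / sqrt n"
      using prob_lb_final_approx[of n "\<lambda>A. card A \<le> K"] sum_prod_walsh_mean_bound[OF n] n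
      unfolding q_def p_def by simp
    moreover have "\<bar>q - std_normal_cdf ((2 * real m - real n) / sqrt n)\<bar> \<le> 8 / sqrt n"
      unfolding q_def using n by (intro binomial_cdf_normal_approx) auto
    moreover have "\<bar>std_normal_cdf ((2 * real m - real n) / sqrt n) - std_normal_cdf (a * z)\<bar> \<le> 2 / sqrt n"
    proof -
      have "\<bar>(2 * real m - real n) / sqrt n - a * z\<bar> = \<bar>2 * real m - 2 * x\<bar> / sqrt n"
        unfolding az diff_divide_distrib[symmetric] by simp
      also have "\<dots> \<le> 2 / sqrt n" using K by (intro divide_right_mono) (auto simp: m_def)
      finally show ?thesis
        using std_normal_cdf_lipschitz[of "(2 * real m - real n) / sqrt n" "a * z"] by linarith
    qed
    moreover have "1 / sqrt n + 8 / sqrt n + 2 / sqrt n = 11 / sqrt n" by (simp add: add_divide_distrib[symmetric])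
    ultimately show ?thesis by linarith
  qed
  then have "\<bar>P - std_normal_cdf z\<bar> \<le> 11 / sqrt n + 1 / sqrt n" using 1 by linarith
  also have "\<dots> \<le> 16 / sqrt n" unfolding add_divide_distrib[symmetric] by (intro divide_right_mono) auto
  finally show ?thesis by (simp add: P_def)
qed

section \<open>The variance\<close>

text \<open>Up to normalisation the Krawtchouk polynomial of degree two; this form shows that the
  factor is of order 1 / n near s = n / 2.\<close>

lemma lam_2:
  assumes "n \<ge> 2"
  shows "lam n 2 s = ((real n - 2 * real s)\<^sup>2 - real n) / (real n * (real n - 1))"
proof -
  have "real n * (real n - 1) \<noteq> 0" using assms by auto
  then show ?thesis
    by (simp add: lam_def ffall_def numeral_2_eq_2 lessThan_Suc field_simps power2_eq_square)
qed

lemma abs_lam_2_le: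
  assumes "n \<ge> 2" "\<bar>(real n - 2 * real s)\<^sup>2 - real n\<bar> \<le> c"
  shows "\<bar>lam n 2 s\<bar> \<le> c / (real n * (real n - 1))"
  using assms by (simp add: lam_2 abs_mult divide_right_mono)

lemma abs_lam_2_le_1:
  assumes "n \<ge> 2" "s \<le> n"
  shows "\<bar>lam n 2 s\<bar> \<le> 1"
proof -
  have "\<bar>real n - 2 * real s\<bar> \<le> \<bar>real n\<bar>" using assms by auto
  then have "(real n - 2 * real s)\<^sup>2 \<le> (real n)\<^sup>2" by (simp only: abs_le_square_iff)
  moreover have "2 * real n \<le> (real n)\<^sup>2" using assms unfolding power2_eq_square by (intro mult_right_mono) auto
  ultimately have "\<bar>(real n - 2 * real s)\<^sup>2 - real n\<bar> \<le> (real n)\<^sup>2 - real n"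
    using zero_le_power2[of "real n - 2 * real s"] by linarith
  from abs_lam_2_le[OF assms(1) this] have "\<bar>lam n 2 s\<bar> \<le> ((real n)\<^sup>2 - real n) / (real n * (real n - 1))" .
  also have "\<dots> \<le> 1" by (simp add: power2_eq_square algebra_simps)
  finally show ?thesis .
qed

text \<open>The square is at most 9 \<le> 2 n, hence within n of n. The range 3 admits s = m - 1
  when n = 2 m + 1.\<close>

lemma abs_lam_2_near_middle:
  assumes "n \<ge> 6" "\<bar>real n - 2 * real s\<bar> \<le> 3"
  shows "\<bar>lam n 2 s\<bar> \<le> 1 / (real n - 1)"
proof -
  have "\<bar>real n - 2 * real s\<bar> \<le> \<bar>3\<bar>" using assms by simp
  then have "(real n - 2 * real s)\<^sup>2 \<le> 3\<^sup>2" by (simp only: abs_le_square_iff)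
  then have "\<bar>(real n - 2 * real s)\<^sup>2 - real n\<bar> \<le> real n"
    using assms(1) zero_le_power2[of "real n - 2 * real s"] by (simp add: abs_le_iff)
  from abs_lam_2_le[OF _ this] show ?thesis using assms(1) by simp
qed

lemma abs_prod_lam_2_le:
  assumes "n \<ge> 6" "A \<subseteq> {1..n}" "I \<subseteq> A" "\<And>s. s \<in> I \<Longrightarrow> \<bar>real n - 2 * real s\<bar> \<le> 3"
  shows "\<bar>\<Prod>s\<in>A. lam n 2 s\<bar> \<le> (1 / (real n - 1)) ^ card I"
proof -
  have fin: "finite A" using assms(2) finite_subset by blast
  have "\<bar>\<Prod>s\<in>A. lam n 2 s\<bar> = (\<Prod>s\<in>A - I. \<bar>lam n 2 s\<bar>) * (\<Prod>s\<in>I. \<bar>lam n 2 s\<bar>)"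
    unfolding abs_prod using assms fin by (intro prod.subset_diff) auto
  also have "\<dots> \<le> 1 * (\<Prod>s\<in>I. 1 / (real n - 1))"
    using assms by (intro mult_mono prod_le_1 prod_mono prod_nonneg)
      (auto intro!: abs_lam_2_le_1 abs_lam_2_near_middle)
  finally show ?thesis by simp
qed

text \<open>The three factors at m - 1, m and m + 1, where n = 2 m, are small.\<close>

lemma abs_lam_std_2_le:
  assumes "even n" "n \<ge> 6"
  shows "\<bar>lam_std n 2\<bar> \<le> (1 / (real n - 1)) ^ 3"
proof -
  obtain m where m: "n = 2 * m" using assms(1) by blast
  have "card {m - 1..m + 1} = 3" using m assms by simp
  moreover have "\<bar>\<Prod>s\<in>{1..n}. lam n 2 s\<bar> \<le> (1 / (real n - 1)) ^ card {m - 1..m + 1}"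
    using m assms(2) by (intro abs_prod_lam_2_le) auto
  ultimately show ?thesis by (simp add: lam_std_def)
qed

text \<open>Both averaged factors inherit the middle bound 1 / (n - 1); the third small factor is
  the one at m - 1.\<close>

lemma abs_lam_bar_std_2_le:
  assumes "odd n" "n \<ge> 7"
  shows "\<bar>lam_bar_std n 2\<bar> \<le> (1 / (real n - 1)) ^ 3"
proof -
  define m where "m = n div 2"
  have m: "n = 2 * m + 1" using assms(1) by (simp add: m_def)
  have "\<bar>\<Prod>s\<in>{1..n} - {m, m + 1}. lam n 2 s\<bar> \<le> (1 / (real n - 1)) ^ card {m - 1}"
    using m assms(2) by (intro abs_prod_lam_2_le) auto
  moreover have "\<bar>(lam n 2 m + lam n 2 (m + 1)) / 2\<bar> \<le> 1 / (real n - 1)"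
  proof -
    have "\<bar>lam n 2 m\<bar> \<le> 1 / (real n - 1)" "\<bar>lam n 2 (m + 1)\<bar> \<le> 1 / (real n - 1)"
      by (rule abs_lam_2_near_middle; use m assms(2) in simp)+
    moreover have "\<bar>(x + y) / 2\<bar> \<le> c" if "\<bar>x\<bar> \<le> c" "\<bar>y\<bar> \<le> c" for x y c :: real
      using that by (simp add: abs_le_iff)
    ultimately show ?thesis by blast
  qed
  then have "\<bar>(lam n 2 m + lam n 2 (m + 1)) / 2\<bar>\<^sup>2 \<le> (1 / (real n - 1))\<^sup>2" by (intro power_mono) auto
  ultimately have "\<bar>\<Prod>s\<in>{1..n} - {m, m + 1}. lam n 2 s\<bar> * \<bar>(lam n 2 m + lam n 2 (m + 1)) / 2\<bar>\<^sup>2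
      \<le> (1 / (real n - 1)) ^ card {m - 1} * (1 / (real n - 1))\<^sup>2"
    using assms by (intro mult_mono) auto
  also have "\<dots> = (1 / (real n - 1)) ^ 3" by (simp add: power_numeral_reduce)
  finally show ?thesis
    unfolding lam_bar_std_def Let_def m_def[symmetric] by (simp only: abs_mult power_abs)
qed

section \<open>Transfer to the stated variance and conclusion\<close>

text \<open>Common to both parities, with \<open>l\<close> the respective product. The variance is n
  / 4 (1 + u) with |u| \<le> 1 / (n - 1)^2, which makes the right side at least 16 / sqrt n. That is
  the available error for n \<ge> 256, and it is at least 1 for smaller n.\<close>

lemma normal_approx_of_variance:
  fixes n :: nat and z l :: real
  assumes n: "n \<ge> 6" and l: "\<bar>l\<bar> \<le> (1 / (real n - 1)) ^ 3"
  defines "\<sigma>2 \<equiv> real n / 4 * (1 - l) + (real n)\<^sup>2 / 4 * l"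
  shows "\<sigma>2 > 0"
    and "\<bar>measure_pmf.prob (std_lb_pmf n) {S. (real (std_lb_X n S) - real n / 2) / sqrt \<sigma>2 \<le> z} - std_normal_cdf z\<bar>
           \<le> 1.64 * real n / sqrt \<sigma>2 ^ 3 + 2 / sqrt \<sigma>2"
proof -
  define u where "u = (real n - 1) * l"
  define a where "a = sqrt (1 + u)"
  have "\<bar>u\<bar> \<le> (real n - 1) * (1 / (real n - 1)) ^ 3"
    unfolding u_def abs_mult using n l by (intro mult_mono) auto
  also have "\<dots> = 1 / (real n - 1) * (1 / (real n - 1))"
    using n by (simp add: power_numeral_reduce)
  finally have u: "\<bar>u\<bar> \<le> 1 / (real n - 1) * (1 / (real n - 1))" .
  also have "\<dots> \<le> 1 / 5 * (1 / 5)" using n by (intro mult_mono) (auto simp: field_simps)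
  finally have u25: "\<bar>u\<bar> \<le> 1/25" by simp
  have \<sigma>2: "\<sigma>2 = real n / 4 * (1 + u)" by (simp add: \<sigma>2_def u_def power2_eq_square field_simps)
  have "1 + u > 0" using u25 by linarith
  then show pos: "\<sigma>2 > 0" unfolding \<sigma>2 using n by simp
  have \<sigma>: "sqrt \<sigma>2 = sqrt n / 2 * a" unfolding \<sigma>2 a_def by (simp add: real_sqrt_mult real_sqrt_divide)
  have a: "a > 0" using u25 by (simp add: a_def)
  \<comment> \<open>Indeed 1 + u \<le> 26/25 < (51/50)^2.\<close>
  have "a \<le> 51/50" unfolding a_def using u25 by (intro real_le_lsqrt) (auto simp: power2_eq_square)
  then have a3: "a ^ 3 \<le> (51/50) ^ 3" using a by (intro power_mono) auto
  have rhs: "16 / sqrt n \<le> 1.64 * real n / sqrt \<sigma>2 ^ 3 + 2 / sqrt \<sigma>2"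
  proof -
    have sn: "sqrt n > 0" "sqrt n * sqrt n = n" using n by auto
    have "1.64 * real n / sqrt \<sigma>2 ^ 3 + 2 / sqrt \<sigma>2
        = 1.64 * (sqrt n * sqrt n) / (sqrt n / 2 * a) ^ 3 + 2 / (sqrt n / 2 * a)"
      by (simp only: \<sigma> sn)
    also have "\<dots> = (13.12 / a ^ 3 + 4 / a) / sqrt n"
    proof -
      have "1.64 * (t * t) / (t / 2 * a) ^ 3 + 2 / (t / 2 * a) = (13.12 / a ^ 3 + 4 / a) / t" if "t > 0" for t
        using that a by (simp add: field_simps power_numeral_reduce)
      then show ?thesis using sn(1) by blast
    qed
    finally have eq: "1.64 * real n / sqrt \<sigma>2 ^ 3 + 2 / sqrt \<sigma>2 = (13.12 / a ^ 3 + 4 / a) / sqrt n" .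
    \<comment> \<open>With sqrt n / 2 as the unit, 1.64 becomes 1.64 * 8 = 13.12 and 2 becomes 4; at
      a = 51/50 the two terms sum to about 16.28.\<close>
    have "13.12 / (51/50) ^ 3 \<le> 13.12 / a ^ 3" using a a3 by (intro divide_left_mono) auto
    moreover have "4 / (51/50) \<le> 4 / a" using a \<open>a \<le> 51/50\<close> by (intro divide_left_mono) auto
    ultimately have "16 \<le> 13.12 / a ^ 3 + 4 / a" by (simp add: power_numeral_reduce)
    then show ?thesis unfolding eq by (intro divide_right_mono) auto
  qed
  have "\<bar>measure_pmf.prob (std_lb_pmf n) {S. (real (std_lb_X n S) - real n / 2) / sqrt \<sigma>2 \<le> z} - std_normal_cdf z\<bar>
       \<le> 16 / sqrt n"
  proof (cases "n \<ge> 256")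
    case True
    have "2 * sqrt \<sigma>2 / sqrt n = a" unfolding \<sigma> using n by simp
    moreover have "\<bar>a - 1\<bar> \<le> 1 / n"
    proof -
      \<comment> \<open>Since a + 1 \<ge> 1, the factorisation of a^2 - 1 bounds |a - 1| by
        |u|.\<close>
      have "(a - 1) * (a + 1) = u" using u25 unfolding a_def by (simp add: algebra_simps)
      then have "\<bar>a - 1\<bar> * \<bar>a + 1\<bar> = \<bar>u\<bar>" by (metis abs_mult)
      moreover have "\<bar>a - 1\<bar> * 1 \<le> \<bar>a - 1\<bar> * \<bar>a + 1\<bar>" using a by (intro mult_left_mono) auto
      ultimately have "\<bar>a - 1\<bar> \<le> \<bar>u\<bar>" by simp
      also note u
      also have "1 / (real n - 1) * (1 / (real n - 1)) \<le> 1 / n"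
      proof -
        have "real n \<le> (real n - 1) * 2" using n by simp
        also have "\<dots> \<le> (real n - 1) * (real n - 1)" using n by (intro mult_left_mono) auto
        finally show ?thesis using n by (simp add: field_simps)
      qed
      finally show ?thesis .
    qed
    ultimately show ?thesis using True pos by (intro lightbulb_normal_approx) auto
  next
    case False
    have "sqrt n \<le> 16" using False by (intro real_le_lsqrt) auto
    then have "1 \<le> 16 / sqrt n" using n by (simp add: le_divide_eq)
    moreover have "\<bar>x - y\<bar> \<le> 1" if "0 \<le> x" "x \<le> 1" "0 \<le> y" "y \<le> 1" for x y :: real
      using that by linarith
    ultimately show ?thesis
      using std_normal_cdf_bounds[of z] measure_pmf.prob_le_1 measure_nonneg by (meson order_trans)
  qed
  then show "\<bar>measure_pmf.prob (std_lb_pmf n) {S. (real (std_lb_X n S) - real n / 2) / sqrt \<sigma>2 \<le> z} - std_normal_cdf z\<bar>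
           \<le> 1.64 * real n / sqrt \<sigma>2 ^ 3 + 2 / sqrt \<sigma>2" using rhs by linarith
qed

theorem theorem1p1:
  shows "(\<forall>n::nat. even n \<and> n \<ge> 6 \<longrightarrow>
           (let \<sigma>2 = real n / 4 * (1 - lam_std n 2) + (real n)^2 / 4 * lam_std n 2;
                \<sigma> = sqrt \<sigma>2;
                \<Delta>0 = 1 / (2 * sqrt (real n)) + 1 / (2 * real n) + 1/3 * exp (- real n / 2)
            in \<forall>z::real.
               \<bar>measure_pmf.prob (std_lb_pmf n) {S. (real (std_lb_X n S) - real n / 2) / \<sigma> \<le> z}
                 - std_normal_cdf z\<bar>
               \<le> real n / (2 * \<sigma>2) * \<Delta>0 + 1.64 * real n / \<sigma> ^ 3 + 2 / \<sigma>))
       \<and> (\<forall>n::nat. odd n \<and> n \<ge> 7 \<longrightarrow>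
           (let \<sigma>2 = real n / 4 * (1 - lam_bar_std n 2) + (real n)^2 / 4 * lam_bar_std n 2;
                \<sigma> = sqrt \<sigma>2;
                \<Delta>1 = 1 / sqrt (real n) + 1 / (2 * sqrt 2) * exp (- real n / 4)
            in \<forall>z::real.
               \<bar>measure_pmf.prob (std_lb_pmf n) {S. (real (std_lb_X n S) - real n / 2) / \<sigma> \<le> z}
                 - std_normal_cdf z\<bar>
               \<le> real n / (2 * \<sigma>2) * \<Delta>1 + 1.64 * real n / \<sigma> ^ 3
                  + 2 / \<sigma> * (1 + 1 / sqrt (2 * pi))))"
proof (intro conjI allI impI)
  fix n :: nat assume n: "even n \<and> n \<ge> 6"
  define \<sigma>2 where "\<sigma>2 = real n / 4 * (1 - lam_std n 2) + (real n)^2 / 4 * lam_std n 2"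
  define \<Delta> where "\<Delta> = 1 / (2 * sqrt (real n)) + 1 / (2 * real n) + 1/3 * exp (- real n / 2)"
  have l: "\<bar>lam_std n 2\<bar> \<le> (1 / (real n - 1)) ^ 3" using n by (intro abs_lam_std_2_le) auto
  have "n \<ge> 6" using n by simp
  note approx = normal_approx_of_variance[OF this l, folded \<sigma>2_def]
  have "0 \<le> \<Delta>" by (simp add: \<Delta>_def)
  then have "0 \<le> real n / (2 * \<sigma>2) * \<Delta>" using approx(1) by simp
  then have "\<bar>measure_pmf.prob (std_lb_pmf n) {S. (real (std_lb_X n S) - real n / 2) / sqrt \<sigma>2 \<le> z} - std_normal_cdf z\<bar>
      \<le> real n / (2 * \<sigma>2) * \<Delta> + 1.64 * real n / sqrt \<sigma>2 ^ 3 + 2 / sqrt \<sigma>2" for z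
    using approx(2)[of z] by linarith
  then show "let \<sigma>2 = real n / 4 * (1 - lam_std n 2) + (real n)^2 / 4 * lam_std n 2;
                \<sigma> = sqrt \<sigma>2;
                \<Delta>0 = 1 / (2 * sqrt (real n)) + 1 / (2 * real n) + 1/3 * exp (- real n / 2)
            in \<forall>z::real.
               \<bar>measure_pmf.prob (std_lb_pmf n) {S. (real (std_lb_X n S) - real n / 2) / \<sigma> \<le> z}
                 - std_normal_cdf z\<bar>
               \<le> real n / (2 * \<sigma>2) * \<Delta>0 + 1.64 * real n / \<sigma> ^ 3 + 2 / \<sigma>"
    unfolding Let_def \<sigma>2_def[symmetric] \<Delta>_def[symmetric] by blast
next
  fix n :: nat assume n: "odd n \<and> n \<ge> 7"
  define \<sigma>2 where "\<sigma>2 = real n / 4 * (1 - lam_bar_std n 2) + (real n)^2 / 4 * lam_bar_std n 2"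
  define \<Delta> where "\<Delta> = 1 / sqrt (real n) + 1 / (2 * sqrt 2) * exp (- real n / 4)"
  have l: "\<bar>lam_bar_std n 2\<bar> \<le> (1 / (real n - 1)) ^ 3" using n by (intro abs_lam_bar_std_2_le) auto
  have "n \<ge> 6" using n by simp
  note approx = normal_approx_of_variance[OF this l, folded \<sigma>2_def]
  have "0 \<le> \<Delta>" by (simp add: \<Delta>_def)
  then have "0 \<le> real n / (2 * \<sigma>2) * \<Delta>" using approx(1) by simp
  \<comment> \<open>In the odd case the last term only grows, by a factor above 1, so the same
    estimate serves.\<close>
  moreover have "2 / sqrt \<sigma>2 * 1 \<le> 2 / sqrt \<sigma>2 * (1 + 1 / sqrt (2 * pi))"
    using approx(1) by (intro mult_left_mono) auto
  ultimately have "\<bar>measure_pmf.prob (std_lb_pmf n) {S. (real (std_lb_X n S) - real n / 2) / sqrt \<sigma>2 \<le> z} - std_normal_cdf z\<bar>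
      \<le> real n / (2 * \<sigma>2) * \<Delta> + 1.64 * real n / sqrt \<sigma>2 ^ 3 + 2 / sqrt \<sigma>2 * (1 + 1 / sqrt (2 * pi))" for z
    using approx(2)[of z] by linarith
  then show "let \<sigma>2 = real n / 4 * (1 - lam_bar_std n 2) + (real n)^2 / 4 * lam_bar_std n 2;
                \<sigma> = sqrt \<sigma>2;
                \<Delta>1 = 1 / sqrt (real n) + 1 / (2 * sqrt 2) * exp (- real n / 4)
            in \<forall>z::real.
               \<bar>measure_pmf.prob (std_lb_pmf n) {S. (real (std_lb_X n S) - real n / 2) / \<sigma> \<le> z}
                 - std_normal_cdf z\<bar>
               \<le> real n / (2 * \<sigma>2) * \<Delta>1 + 1.64 * real n / \<sigma> ^ 3
                  + 2 / \<sigma> * (1 + 1 / sqrt (2 * pi))"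
    unfolding Let_def \<sigma>2_def[symmetric] \<Delta>_def[symmetric] by blast
qed

end
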